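(* Let $Q$ be a commutative unital quantale. For every $Q$-context $(X,Y,\alpha)$, i.e. every pair of sets $X,Y$ with a $Q$-relation $\alpha\colon X\nrightarrow Y$, there is a canonical isomorphism of $Q$-categories $$\mathfrak{P}(X,Y,\alpha)\;\cong\;\mathfrak{D}\alpha,\qquad(\lambda,\mu)\mapsto\mu,$$ between the property-oriented concept lattice of $(X,Y,\alpha)$ and $\mathfrak{D}\alpha=\mathbf{D}(Q\text{-}\mathbf{Rel})(\alpha,\star_{\mathrm{k}})$. Accordingly, the property-oriented concept lattice construction $(X,Y,\alpha)\mapsto\mathfrak{P}(X,Y,\alpha)$ is functorial over $\mathbf{D}(Q\text{-}\mathbf{Rel})^{\mathrm{op}}$, i.e. via these isomorphisms it is the object assignment of a functor $\mathbf{D}(Q\text{-}\mathbf{Rel})^{\mathrm{op}}\to Q\text{-}\mathbf{Sup}$ isomorphic to the representable functor $\mathfrak{D}=\mathbf{D}(Q\text{-}\mathbf{Rel})(-,\star_{\mathrm{k}})$.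
   Context: A commutative unital quantale $Q$ is a complete lattice with a commutative associative operation $\&$ with unit $\mathrm{k}$ distributing over arbitrary joins in each variable; $a\to(-)$ is the right adjoint of $a\&(-)$. A $Q$-relation $\alpha\colon X\nrightarrow Y$ is a map $X\times Y\to Q$, ordered pointwise. For $\alpha\colon X\nrightarrow Y$, $\beta\colon Y\nrightarrow Z$, $\gamma\colon X\nrightarrow Z$: $(\beta\circ\alpha)(x,z)=\bigvee_{y}\beta(y,z)\&\alpha(x,y)$, $(\gamma\swarrow\alpha)(y,z)=\bigwedge_{x}\alpha(x,y)\to\gamma(x,z)$, $(\beta\searrow\gamma)(x,y)=\bigwedge_{z}\beta(y,z)\to\gamma(x,z)$. Scalar multiplication: $(q\&\alpha)(x,y)=q\&\alpha(x,y)$. $Q$-relations $\{\star\}\nrightarrow\{\star\}$ are identified with elements of $Q$. A $Q$-category $\mathbb{A}$ is a set $\mathbb{A}_0$ with $\mathbb{A}\colon\mathbb{A}_0\times\mathbb{A}_0\to Q$ such that $\mathrm{k}\le\mathbb{A}(x,x)$ and $\mathbb{A}(y,z)\&\mathbb{A}(x,y)\le\mathbb{A}(x,z)$; its underlying preorder is $x\le y\iff\mathrm{k}\le\mathbb{A}(x,y)$, and $\mathbb{A}$ is skeletal if this is a partial order. A $Q$-functor is a map $F$ with $\mathbb{A}(x,y)\le\mathbb{B}(Fx,Fy)$; $F\dashv G$ means $\mathbb{B}(Fx,y)=\mathbb{A}(x,Gy)$. $\mathbb{A}$ is cocomplete if its Yoneda embedding into the $Q$-category of presheaves has a left adjoint.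 $Q\text{-}\mathbf{Sup}$ is the category of skeletal cocomplete $Q$-categories and left adjoint $Q$-functors. Skeletal cocomplete $Q$-categories correspond to $Q$-modules, i.e. complete lattices with an action $q\cdot x$ of the monoid $(Q,\&,\mathrm{k})$ preserving joins in each variable, via $\mathbb{A}(x,y)=\bigvee\{q\in Q\mid q\cdot x\le y\}$; left adjoint $Q$-functors correspond to maps preserving joins and the action. A property-oriented concept of $(X,Y,\alpha)$ is a pair $(\lambda\colon Y\nrightarrow\{\star\},\ \mu\colon X\nrightarrow\{\star\})$ with $\lambda=\mu\swarrow\alpha$ and $\mu=\lambda\circ\alpha$. The property-oriented concept lattice $\mathfrak{P}(X,Y,\alpha)$ is the skeletal cocomplete $Q$-category of all such pairs, with hom $\mathfrak{P}(X,Y,\alpha)((\lambda,\mu),(\lambda',\mu'))=\lambda'\swarrow\lambda=\mu'\swarrow\mu$. The diagonal category $\mathbf{D}(Q\text{-}\mathbf{Rel})$ has all $Q$-relations as objects; a morphism from $\alpha\colon X\nrightarrow Y$ to $\beta\colon X'\nrightarrow Y'$ is a $Q$-relation $f\colon X\nrightarrow Y'$ with $(f\swarrow\alpha)\circ\alpha=f=\beta\circ(\beta\searrow f)$ (equivalently, $f=v\circ\alpha=\beta\circ u$ for some $u\colon X\nrightarrow X'$, $v\colon Y\nrightarrow Y'$). The composite of $f\colon\alpha\to\beta$ and $g\colon\beta\to\gamma$ is $g\odot f=g\circ(\beta\searrow f)=(g\swarrow\beta)\circ f$, and the identity on $\alpha$ is $\alpha$. Hom-sets carry the pointwise order and the $Q$-action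 $q\cdot f=q\& f$; this makes $\mathbf{D}(Q\text{-}\mathbf{Rel})$ enriched in $Q\text{-}\mathbf{Sup}$. $\star_{\mathrm{k}}\colon\{\star\}\nrightarrow\{\star\}$ is the identity $Q$-relation on the singleton, with value $\mathrm{k}$. The functor $\mathfrak{D}=\mathbf{D}(Q\text{-}\mathbf{Rel})(-,\star_{\mathrm{k}})\colon\mathbf{D}(Q\text{-}\mathbf{Rel})^{\mathrm{op}}\to Q\text{-}\mathbf{Sup}$ sends $\alpha$ to $\mathfrak{D}\alpha=\mathbf{D}(Q\text{-}\mathbf{Rel})(\alpha,\star_{\mathrm{k}})$ and $f\colon\beta\to\alpha$ to $\mathfrak{D}f\colon\mathfrak{D}\alpha\to\mathfrak{D}\beta$, $\mathfrak{D}f(\lambda)=\lambda\odot f$. *)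

theory Defs
  imports "HOL-Library.FuncSet"
begin

section \<open>Commutative unital quantales\<close>

text \<open>The tensor is written \<open>*\<close> and the unit \<open>k\<close> is \<open>1\<close>; the unit need not be the top element.\<close>

class comm_unital_quantale = complete_lattice + comm_monoid_mult +
  assumes mult_Sup_distrib: "a * Sup B = (SUP b\<in>B. a * b)"

definition qimp :: "'q::comm_unital_quantale \<Rightarrow> 'q \<Rightarrow> 'q"  (infixr "\<rightarrow>\<^sub>Q" 65)
  where "a \<rightarrow>\<^sub>Q b = Sup {c. a * c \<le> b}"

lemma qimp_adjoint: "a * c \<le> b \<longleftrightarrow> c \<le> a \<rightarrow>\<^sub>Q (b :: 'q::comm_unital_quantale)"
proof
  assume "a * c \<le> b"
  then show "c \<le> a \<rightarrow>\<^sub>Q b" by (auto simp: qimp_def intro: Sup_upper)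
next
  assume "c \<le> a \<rightarrow>\<^sub>Q b"
  then have "sup c (a \<rightarrow>\<^sub>Q b) = a \<rightarrow>\<^sub>Q b" by (rule sup_absorb2)
  moreover have "a * sup c (a \<rightarrow>\<^sub>Q b) = sup (a * c) (a * (a \<rightarrow>\<^sub>Q b))"
    using mult_Sup_distrib[of a "{c, a \<rightarrow>\<^sub>Q b}"] by simp
  ultimately have "a * c \<le> a * (a \<rightarrow>\<^sub>Q b)" by (simp add: le_iff_sup)
  also have "\<dots> \<le> b" unfolding qimp_def mult_Sup_distrib by (rule SUP_least) simp
  finally show "a * c \<le> b" .
qed


section \<open>Q-relations\<close>

text \<open>
  A Q-relation carries its source and target sets. Its value function is extensional, so that
  equality of records is equality of maps \<open>X \<times> Y \<rightarrow> Q\<close>. The operations below are meaningful only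
  when the sources and targets match.
\<close>

record ('x, 'y, 'q) qrel =
  src :: "'x set"
  tgt :: "'y set"
  val :: "'x \<times> 'y \<Rightarrow> 'q"

definition Rel :: "'x set \<Rightarrow> 'y set \<Rightarrow> ('x, 'y, 'q) qrel set" where
  "Rel X Y = {\<alpha>. src \<alpha> = X \<and> tgt \<alpha> = Y \<and> val \<alpha> \<in> extensional (X \<times> Y)}"

definition rcomp :: "('y, 'z, 'q::comm_unital_quantale) qrel \<Rightarrow> ('x, 'y, 'q) qrel \<Rightarrow> ('x, 'z, 'q) qrel"
    (infixl "\<circ>\<^sub>Q" 70) where
  "\<beta> \<circ>\<^sub>Q \<alpha> = \<lparr>src = src \<alpha>, tgt = tgt \<beta>,
     val = (\<lambda>(x, z)\<in>src \<alpha> \<times> tgt \<beta>. SUP y\<in>tgt \<alpha>. val \<beta> (y, z) * val \<alpha> (x, y))\<rparr>"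

text \<open>\<open>\<gamma> \<Down>\<^sub>Q \<alpha>\<close> is the south-west arrow and \<open>\<beta> \<Rrightarrow>\<^sub>Q \<gamma>\<close> the south-east arrow: the right adjoints of
  \<open>- \<circ>\<^sub>Q \<alpha>\<close> and \<open>\<beta> \<circ>\<^sub>Q -\<close> respectively.\<close>

definition res_sw :: "('x, 'z, 'q::comm_unital_quantale) qrel \<Rightarrow> ('x, 'y, 'q) qrel \<Rightarrow> ('y, 'z, 'q) qrel"
    (infix "\<Down>\<^sub>Q" 70) where
  "\<gamma> \<Down>\<^sub>Q \<alpha> = \<lparr>src = tgt \<alpha>, tgt = tgt \<gamma>,
     val = (\<lambda>(y, z)\<in>tgt \<alpha> \<times> tgt \<gamma>. INF x\<in>src \<alpha>. val \<alpha> (x, y) \<rightarrow>\<^sub>Q val \<gamma> (x, z))\<rparr>"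

definition res_se :: "('y, 'z, 'q::comm_unital_quantale) qrel \<Rightarrow> ('x, 'z, 'q) qrel \<Rightarrow> ('x, 'y, 'q) qrel"
    (infix "\<Rrightarrow>\<^sub>Q" 70) where
  "\<beta> \<Rrightarrow>\<^sub>Q \<gamma> = \<lparr>src = src \<gamma>, tgt = src \<beta>,
     val = (\<lambda>(x, y)\<in>src \<gamma> \<times> src \<beta>. INF z\<in>tgt \<gamma>. val \<beta> (y, z) \<rightarrow>\<^sub>Q val \<gamma> (x, z))\<rparr>"

definition rel_le :: "('x, 'y, 'q::comm_unital_quantale) qrel \<Rightarrow> ('x, 'y, 'q) qrel \<Rightarrow> bool" where
  "rel_le \<alpha> \<beta> \<longleftrightarrow> (\<forall>x\<in>src \<alpha>. \<forall>y\<in>tgt \<alpha>. val \<alpha> (x, y) \<le> val \<beta> (x, y))"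

definition scal :: "'q::comm_unital_quantale \<Rightarrow> ('x, 'y, 'q) qrel \<Rightarrow> ('x, 'y, 'q) qrel" where
  "scal q \<alpha> = \<lparr>src = src \<alpha>, tgt = tgt \<alpha>, val = (\<lambda>p\<in>src \<alpha> \<times> tgt \<alpha>. q * val \<alpha> p)\<rparr>"

text \<open>The one-point set is \<open>{s}\<close>, for a point \<open>s\<close> of the universe type under consideration.\<close>

definition star_k :: "'s \<Rightarrow> ('s, 's, 'q::comm_unital_quantale) qrel" where
  "star_k s = \<lparr>src = {s}, tgt = {s}, val = (\<lambda>p\<in>{s} \<times> {s}. 1)\<rparr>"


section \<open>Q-categories\<close>

text \<open>Values of \<open>hom\<close> outside \<open>ob\<close> are irrelevant.\<close>

record ('a, 'q) qcat =
  ob :: "'a set"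
  hom :: "'a \<Rightarrow> 'a \<Rightarrow> 'q"

definition qcategory :: "('a, 'q::comm_unital_quantale) qcat \<Rightarrow> bool" where
  "qcategory A \<longleftrightarrow> (\<forall>x\<in>ob A. 1 \<le> hom A x x) \<and>
     (\<forall>x\<in>ob A. \<forall>y\<in>ob A. \<forall>z\<in>ob A. hom A y z * hom A x y \<le> hom A x z)"

definition skeletal :: "('a, 'q::comm_unital_quantale) qcat \<Rightarrow> bool" where
  "skeletal A \<longleftrightarrow> (\<forall>x\<in>ob A. \<forall>y\<in>ob A. 1 \<le> hom A x y \<longrightarrow> 1 \<le> hom A y x \<longrightarrow> x = y)"

definition qfunctor :: "('a, 'q::comm_unital_quantale) qcat \<Rightarrow> ('b, 'q) qcat \<Rightarrow> ('a \<Rightarrow> 'b) \<Rightarrow> bool" where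
  "qfunctor A B F \<longleftrightarrow> F \<in> ob A \<rightarrow> ob B \<and> (\<forall>x\<in>ob A. \<forall>y\<in>ob A. hom A x y \<le> hom B (F x) (F y))"

definition qadjoint ::
    "('a, 'q::comm_unital_quantale) qcat \<Rightarrow> ('b, 'q) qcat \<Rightarrow> ('a \<Rightarrow> 'b) \<Rightarrow> ('b \<Rightarrow> 'a) \<Rightarrow> bool" where
  "qadjoint A B F G \<longleftrightarrow> qfunctor A B F \<and> qfunctor B A G \<and>
     (\<forall>x\<in>ob A. \<forall>y\<in>ob B. hom B (F x) y = hom A x (G y))"

definition qcat_iso :: "('a, 'q::comm_unital_quantale) qcat \<Rightarrow> ('b, 'q) qcat \<Rightarrow> ('a \<Rightarrow> 'b) \<Rightarrow> bool" where
  "qcat_iso A B F \<longleftrightarrow> qcategory A \<and> qcategory B \<and> qfunctor A B F \<and>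
     (\<exists>G. qfunctor B A G \<and> (\<forall>x\<in>ob A. G (F x) = x) \<and> (\<forall>y\<in>ob B. F (G y) = y))"

definition presheaves :: "('a, 'q::comm_unital_quantale) qcat \<Rightarrow> ('a \<Rightarrow> 'q, 'q) qcat" where
  "presheaves A =
     \<lparr>ob = {\<mu> \<in> extensional (ob A). \<forall>x\<in>ob A. \<forall>y\<in>ob A. \<mu> y * hom A x y \<le> \<mu> x},
      hom = (\<lambda>\<mu> \<nu>. INF x\<in>ob A. \<mu> x \<rightarrow>\<^sub>Q \<nu> x)\<rparr>"

definition yoneda :: "('a, 'q::comm_unital_quantale) qcat \<Rightarrow> 'a \<Rightarrow> ('a \<Rightarrow> 'q)" where
  "yoneda A a = (\<lambda>x\<in>ob A. hom A x a)"

definition cocomplete :: "('a, 'q::comm_unital_quantale) qcat \<Rightarrow> bool" where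
  "cocomplete A \<longleftrightarrow> (\<exists>S. qadjoint (presheaves A) A S (yoneda A))"


section \<open>Categories and functors\<close>

text \<open>Hom-sets of different pairs of objects are not assumed disjoint, hence identities and
  composition are indexed by objects: \<open>Comp C a b c g f\<close> is \<open>g\<close> after \<open>f\<close>, for \<open>f : a \<rightarrow> b\<close>
  and \<open>g : b \<rightarrow> c\<close>.\<close>

record ('o, 'm) cat =
  Obj :: "'o set"
  Arr :: "'o \<Rightarrow> 'o \<Rightarrow> 'm set"
  Ident :: "'o \<Rightarrow> 'm"
  Comp :: "'o \<Rightarrow> 'o \<Rightarrow> 'o \<Rightarrow> 'm \<Rightarrow> 'm \<Rightarrow> 'm"

definition is_category :: "('o, 'm) cat \<Rightarrow> bool" where
  "is_category C \<longleftrightarrow>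
     (\<forall>a\<in>Obj C. Ident C a \<in> Arr C a a) \<and>
     (\<forall>a\<in>Obj C. \<forall>b\<in>Obj C. \<forall>c\<in>Obj C. \<forall>f\<in>Arr C a b. \<forall>g\<in>Arr C b c.
        Comp C a b c g f \<in> Arr C a c) \<and>
     (\<forall>a\<in>Obj C. \<forall>b\<in>Obj C. \<forall>f\<in>Arr C a b.
        Comp C a a b f (Ident C a) = f \<and> Comp C a b b (Ident C b) f = f) \<and>
     (\<forall>a\<in>Obj C. \<forall>b\<in>Obj C. \<forall>c\<in>Obj C. \<forall>d\<in>Obj C. \<forall>f\<in>Arr C a b. \<forall>g\<in>Arr C b c. \<forall>h\<in>Arr C c d.
        Comp C a c d h (Comp C a b c g f) = Comp C a b d (Comp C b c d h g) f)"

definition op_cat :: "('o, 'm) cat \<Rightarrow> ('o, 'm) cat" where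
  "op_cat C = \<lparr>Obj = Obj C, Arr = (\<lambda>a b. Arr C b a), Ident = Ident C,
     Comp = (\<lambda>a b c g f. Comp C c b a f g)\<rparr>"

text \<open>A functor consists of an object map \<open>Fo\<close> and, for objects \<open>a, b\<close>, a map \<open>Fm a b\<close> on \<open>Arr C a b\<close>.\<close>

definition is_functor ::
    "('o, 'm) cat \<Rightarrow> ('p, 'n) cat \<Rightarrow> ('o \<Rightarrow> 'p) \<Rightarrow> ('o \<Rightarrow> 'o \<Rightarrow> 'm \<Rightarrow> 'n) \<Rightarrow> bool" where
  "is_functor C D Fo Fm \<longleftrightarrow> is_category C \<and> is_category D \<and>
     (\<forall>a\<in>Obj C. Fo a \<in> Obj D) \<and>
     (\<forall>a\<in>Obj C. \<forall>b\<in>Obj C. \<forall>f\<in>Arr C a b. Fm a b f \<in> Arr D (Fo a) (Fo b)) \<and>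
     (\<forall>a\<in>Obj C. Fm a a (Ident C a) = Ident D (Fo a)) \<and>
     (\<forall>a\<in>Obj C. \<forall>b\<in>Obj C. \<forall>c\<in>Obj C. \<forall>f\<in>Arr C a b. \<forall>g\<in>Arr C b c.
        Fm a c (Comp C a b c g f) = Comp D (Fo a) (Fo b) (Fo c) (Fm b c g) (Fm a b f))"


section \<open>The category Q-Sup\<close>

definition qsup_arr :: "('a, 'q::comm_unital_quantale) qcat \<Rightarrow> ('b, 'q) qcat \<Rightarrow> ('a \<Rightarrow> 'b) set" where
  "qsup_arr A B = {F \<in> extensional (ob A). \<exists>G. qadjoint A B F G}"

definition QSup :: "(('a, 'q::comm_unital_quantale) qcat, 'a \<Rightarrow> 'a) cat" where
  "QSup = \<lparr>Obj = {A. qcategory A \<and> skeletal A \<and> cocomplete A},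
     Arr = qsup_arr,
     Ident = (\<lambda>A. \<lambda>x\<in>ob A. x),
     Comp = (\<lambda>A B C G F. compose (ob A) G F)\<rparr>"

definition qsup_iso :: "('a, 'q::comm_unital_quantale) qcat \<Rightarrow> ('b, 'q) qcat \<Rightarrow> ('a \<Rightarrow> 'b) \<Rightarrow> bool" where
  "qsup_iso A B F \<longleftrightarrow> F \<in> qsup_arr A B \<and>
     (\<exists>G\<in>qsup_arr B A. (\<forall>x\<in>ob A. G (F x) = x) \<and> (\<forall>y\<in>ob B. F (G y) = y))"

text \<open>
  Natural isomorphism of functors \<open>C \<rightarrow> Q-Sup\<close>. The carriers of the values of the two functors
  may live in different types \<open>'a\<close>, \<open>'b\<close>, so that the functors formally map into \<^const>\<open>QSup\<close> at two
  different types; the components are nevertheless isomorphisms of \<open>Q-Sup\<close>.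
\<close>

definition qsup_nat_iso ::
    "('o, 'm) cat
     \<Rightarrow> ('o \<Rightarrow> ('a, 'q::comm_unital_quantale) qcat) \<Rightarrow> ('o \<Rightarrow> 'o \<Rightarrow> 'm \<Rightarrow> ('a \<Rightarrow> 'a))
     \<Rightarrow> ('o \<Rightarrow> ('b, 'q) qcat) \<Rightarrow> ('o \<Rightarrow> 'o \<Rightarrow> 'm \<Rightarrow> ('b \<Rightarrow> 'b))
     \<Rightarrow> ('o \<Rightarrow> 'a \<Rightarrow> 'b) \<Rightarrow> bool" where
  "qsup_nat_iso C Fo Fm Go Gm \<phi> \<longleftrightarrow>
     is_functor C QSup Fo Fm \<and> is_functor C QSup Go Gm \<and>
     (\<forall>a\<in>Obj C. qsup_iso (Fo a) (Go a) (\<phi> a)) \<and>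
     (\<forall>a\<in>Obj C. \<forall>b\<in>Obj C. \<forall>f\<in>Arr C a b. \<forall>x\<in>ob (Fo a).
        \<phi> b (Fm a b f x) = Gm a b f (\<phi> a x))"


section \<open>The diagonal category of Q-Rel and its representable functor\<close>

definition dhom :: "('x, 'y, 'q::comm_unital_quantale) qrel \<Rightarrow> ('u, 'v, 'q) qrel \<Rightarrow> ('x, 'v, 'q) qrel set" where
  "dhom \<alpha> \<beta> = {f \<in> Rel (src \<alpha>) (tgt \<beta>). (f \<Down>\<^sub>Q \<alpha>) \<circ>\<^sub>Q \<alpha> = f \<and> f = \<beta> \<circ>\<^sub>Q (\<beta> \<Rrightarrow>\<^sub>Q f)}"

text \<open>The objects are all Q-relations between subsets of a universe type \<open>'u\<close>.\<close>

definition DRel :: "(('u, 'u, 'q::comm_unital_quantale) qrel, ('u, 'u, 'q) qrel) cat" where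
  "DRel = \<lparr>Obj = {\<alpha>. \<alpha> \<in> Rel (src \<alpha>) (tgt \<alpha>)},
     Arr = dhom,
     Ident = (\<lambda>\<alpha>. \<alpha>),
     Comp = (\<lambda>\<alpha> \<beta> \<gamma> g f. g \<circ>\<^sub>Q (\<beta> \<Rrightarrow>\<^sub>Q f))\<rparr>"

text \<open>The hom of \<open>D_ob s \<alpha>\<close> is the Q-category structure of the Q-module of morphisms \<open>\<alpha> \<rightarrow> star_k s\<close>.
  In \<open>D_arr s \<alpha> \<beta> f\<close>, the arrow \<open>f\<close> goes from \<open>\<alpha>\<close> to \<open>\<beta>\<close> in \<open>op_cat DRel\<close>.\<close>

definition D_ob :: "'u \<Rightarrow> ('u, 'u, 'q::comm_unital_quantale) qrel \<Rightarrow> (('u, 'u, 'q) qrel, 'q) qcat" where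
  "D_ob s \<alpha> = \<lparr>ob = Arr DRel \<alpha> (star_k s), hom = (\<lambda>f g. Sup {q. rel_le (scal q f) g})\<rparr>"

definition D_arr :: "'u \<Rightarrow> ('u, 'u, 'q::comm_unital_quantale) qrel \<Rightarrow> ('u, 'u, 'q) qrel
    \<Rightarrow> ('u, 'u, 'q) qrel \<Rightarrow> (('u, 'u, 'q) qrel \<Rightarrow> ('u, 'u, 'q) qrel)" where
  "D_arr s \<alpha> \<beta> f = (\<lambda>l\<in>ob (D_ob s \<alpha>). Comp DRel \<beta> \<alpha> (star_k s) l f)"


section \<open>Property-oriented concept lattices\<close>

definition property_concepts ::
    "'s \<Rightarrow> ('x, 'y, 'q::comm_unital_quantale) qrel \<Rightarrow> (('y, 's, 'q) qrel \<times> ('x, 's, 'q) qrel) set" where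
  "property_concepts s \<alpha> = {(l, m). l \<in> Rel (tgt \<alpha>) {s} \<and> m \<in> Rel (src \<alpha>) {s} \<and>
     l = m \<Down>\<^sub>Q \<alpha> \<and> m = l \<circ>\<^sub>Q \<alpha>}"

definition concept_lattice ::
    "'s \<Rightarrow> ('x, 'y, 'q::comm_unital_quantale) qrel \<Rightarrow> (('y, 's, 'q) qrel \<times> ('x, 's, 'q) qrel, 'q) qcat" where
  "concept_lattice s \<alpha> = \<lparr>ob = property_concepts s \<alpha>,
     hom = (\<lambda>(l, m) (l', m'). val (l' \<Down>\<^sub>Q l) (s, s))\<rparr>"

end

theory Submission
  imports Defs
begin

text \<open>
  A concept is determined by \<open>\<mu>\<close>, and the possible \<open>\<mu>\<close> are the fixed points of
  \<open>\<mu> \<mapsto> (\<mu> \<Down>\<^sub>Q \<alpha>) \<circ>\<^sub>Q \<alpha>\<close>, that is, the Q-relations of the form \<open>v \<circ>\<^sub>Q \<alpha>\<close>; since every Q-relation into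
  the one-point set factors through \<open>star_k s\<close>, these are exactly the diagonal morphisms \<open>\<alpha> \<rightarrow> star_k s\<close>.
  The right adjoint \<open>- \<Down>\<^sub>Q \<alpha>\<close> of \<open>- \<circ>\<^sub>Q \<alpha>\<close> is compatible with the Q-action, which identifies the two homs.
  Conjugating the representable functor by these isomorphisms makes the concept lattice functorial.
\<close>

section \<open>Quantales and Q-categories\<close>

text \<open>Joins are the only structure that \<open>*\<close> is assumed to preserve, so
  monotonicity is read off the adjunction: its unit
  \<open>z \<le> x \<rightarrow>\<^sub>Q x * z\<close> handles the second variable, and
  commutativity the first.\<close>

lemma quantale_mult_mono:
  fixes a b c d :: "'q::comm_unital_quantale"
  assumes "a \<le> b" "c \<le> d"
  shows "a * c \<le> b * d"
proof -
  have *: "x * y \<le> x * z" if "y \<le> z" for x y z :: 'q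
    using order_trans[OF that qimp_adjoint[THEN iffD1, OF order_refl]] by (simp add: qimp_adjoint)
  have "a * c \<le> a * d" "d * a \<le> d * b"
    using assms * by simp_all
  then show ?thesis by (simp add: mult.commute)
qed

lemma quantale_mult_SUP:
  fixes a :: "'q::comm_unital_quantale"
  shows "a * (SUP i\<in>I. f i) = (SUP i\<in>I. a * f i)"
  by (simp add: mult_Sup_distrib image_image)

lemma quantale_SUP_mult:
  fixes a :: "'q::comm_unital_quantale"
  shows "(SUP i\<in>I. f i) * a = (SUP i\<in>I. f i * a)"
  using quantale_mult_SUP[of a f I] by (simp add: mult.commute)

section \<open>Q-adjunctions, presheaves and cocompleteness\<close>

lemma qcategoryD:
  assumes "qcategory A"
  shows "x \<in> ob A \<Longrightarrow> 1 \<le> hom A x x"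
    and "x \<in> ob A \<Longrightarrow> y \<in> ob A \<Longrightarrow> z \<in> ob A \<Longrightarrow> hom A y z * hom A x y \<le> hom A x z"
  using assms by (auto simp: qcategory_def)

text \<open>Functoriality of both maps follows from the hom identity. Reflexivity at
  \<open>F x'\<close> gives the unit \<open>1 \<le> hom A x' (G (F x'))\<close>; composing with it
  sends \<open>hom A x x'\<close> below \<open>hom A x (G (F x'))\<close>, which is
  \<open>hom B (F x) (F x')\<close>. The counit does the same for \<open>G\<close>.\<close>

lemma qadjointI:
  assumes A: "qcategory A" and B: "qcategory B"
    and F: "F \<in> ob A \<rightarrow> ob B" and G: "G \<in> ob B \<rightarrow> ob A"
    and adj: "\<And>x y. x \<in> ob A \<Longrightarrow> y \<in> ob B \<Longrightarrow> hom B (F x) y = hom A x (G y)"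
  shows "qadjoint A B F G"
proof -
  have Fx: "F x \<in> ob B" if "x \<in> ob A" for x using F that by blast
  have Gy: "G y \<in> ob A" if "y \<in> ob B" for y using G that by blast
  have "hom A x x' \<le> hom B (F x) (F x')" if x: "x \<in> ob A" "x' \<in> ob A" for x x'
  proof -
    have "1 \<le> hom A x' (G (F x'))"
      using qcategoryD(1)[OF B, of "F x'"] adj[of x' "F x'"] x by (simp add: Fx)
    then have "1 * hom A x x' \<le> hom A x' (G (F x')) * hom A x x'"
      by (rule quantale_mult_mono) simp
    also have "\<dots> \<le> hom A x (G (F x'))"
      using qcategoryD(2)[OF A, of x x' "G (F x')"] x by (simp add: Fx Gy)
    also have "\<dots> = hom B (F x) (F x')"
      using adj[of x "F x'"] x by (simp add: Fx)
    finally show ?thesis by simp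
  qed
  moreover have "hom B y y' \<le> hom A (G y) (G y')" if y: "y \<in> ob B" "y' \<in> ob B" for y y'
  proof -
    have "1 \<le> hom B (F (G y)) y"
      using qcategoryD(1)[OF A, of "G y"] adj[of "G y" y] y by (simp add: Gy)
    then have "hom B y y' * 1 \<le> hom B y y' * hom B (F (G y)) y"
      by (intro quantale_mult_mono) simp_all
    also have "\<dots> \<le> hom B (F (G y)) y'"
      using qcategoryD(2)[OF B, of "F (G y)" y y'] y by (simp add: Fx Gy)
    also have "\<dots> = hom A (G y) (G y')"
      using adj[of "G y" y'] y by (simp add: Gy)
    finally show ?thesis by simp
  qed
  ultimately show ?thesis
    using F G adj by (auto simp: qadjoint_def qfunctor_def)
qed

lemma qcategory_presheaves: "qcategory (presheaves A)"
  unfolding qcategory_def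
proof (intro conjI ballI)
  fix f assume "f \<in> ob (presheaves A)"
  show "1 \<le> hom (presheaves A) f f"
    by (auto simp: presheaves_def intro!: INF_greatest simp flip: qimp_adjoint)
next
  fix f g h
  show "hom (presheaves A) g h * hom (presheaves A) f g \<le> hom (presheaves A) f h"
    unfolding presheaves_def qcat.simps
  proof (rule INF_greatest)
    fix x assume x: "x \<in> ob A"
    have "f x * (INF x\<in>ob A. f x \<rightarrow>\<^sub>Q g x) \<le> g x" "g x * (INF x\<in>ob A. g x \<rightarrow>\<^sub>Q h x) \<le> h x"
      using x by (auto simp: qimp_adjoint intro: INF_lower)
    then have "f x * (INF x\<in>ob A. f x \<rightarrow>\<^sub>Q g x) * (INF x\<in>ob A. g x \<rightarrow>\<^sub>Q h x) \<le> h x"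
      by (meson order_refl order_trans quantale_mult_mono)
    then show "(INF x\<in>ob A. g x \<rightarrow>\<^sub>Q h x) * (INF x\<in>ob A. f x \<rightarrow>\<^sub>Q g x) \<le> f x \<rightarrow>\<^sub>Q h x"
      by (simp add: ac_simps flip: qimp_adjoint)
  qed
qed

lemma yoneda_presheaf:
  assumes "qcategory A" "a \<in> ob A"
  shows "yoneda A a \<in> ob (presheaves A)"
  using assms by (auto simp: presheaves_def yoneda_def qcategory_def)

text \<open>The presheaf hom from \<mu> to \<open>yoneda A y\<close> is the infimum on the right, so
  a left adjoint of the Yoneda embedding picks an object representing it, the colimit of the
  identity weighted by \<mu>. Conversely, representing objects chosen one presheaf at a time form a
  left adjoint, because \<open>qadjointI\<close> needs no functoriality beforehand.\<close>

lemma cocomplete_iff_colimits: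
  assumes A: "qcategory A"
  shows "cocomplete A \<longleftrightarrow> (\<forall>\<mu>\<in>ob (presheaves A). \<exists>c\<in>ob A. \<forall>y\<in>ob A.
    hom A c y = (INF x\<in>ob A. \<mu> x \<rightarrow>\<^sub>Q hom A x y))"
proof -
  have hom_y: "hom (presheaves A) \<mu> (yoneda A y) = (INF x\<in>ob A. \<mu> x \<rightarrow>\<^sub>Q hom A x y)" for \<mu> y
    by (simp add: presheaves_def yoneda_def cong: INF_cong)
  show ?thesis (is "_ \<longleftrightarrow> ?R")
  proof
    assume "cocomplete A"
    then obtain S where "qadjoint (presheaves A) A S (yoneda A)"
      by (auto simp: cocomplete_def)
    then have "\<forall>\<mu>\<in>ob (presheaves A). S \<mu> \<in> ob A \<and>
        (\<forall>y\<in>ob A. hom A (S \<mu>) y = (INF x\<in>ob A. \<mu> x \<rightarrow>\<^sub>Q hom A x y))"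
      by (simp add: qadjoint_def qfunctor_def hom_y Pi_iff)
    then show ?R by blast
  next
    assume ?R
    then obtain S where "\<forall>\<mu>\<in>ob (presheaves A). S \<mu> \<in> ob A \<and>
        (\<forall>y\<in>ob A. hom A (S \<mu>) y = (INF x\<in>ob A. \<mu> x \<rightarrow>\<^sub>Q hom A x y))"
      by metis
    then have "qadjoint (presheaves A) A S (yoneda A)"
      by (intro qadjointI qcategory_presheaves A) (auto simp: hom_y yoneda_presheaf[OF A])
    then show "cocomplete A" by (auto simp: cocomplete_def)
  qed
qed

section \<open>Isomorphisms of Q-categories and transport of functors\<close>

text \<open>A functor and its inverse bound the homs from both sides, hence preserve them exactly.
  This form no longer mentions the inverse and is the one checked for concept lattices.\<close>

lemma qcat_iso_iff:
  "qcat_iso A B F \<longleftrightarrow> qcategory A \<and> qcategory B \<and> bij_betw F (ob A) (ob B) \<and>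
     (\<forall>x\<in>ob A. \<forall>y\<in>ob A. hom B (F x) (F y) = hom A x y)" (is "?L \<longleftrightarrow> ?R")
proof
  assume ?L
  then obtain G where *: "qcategory A" "qcategory B" "qfunctor A B F" "qfunctor B A G"
    "\<forall>x\<in>ob A. G (F x) = x" "\<forall>y\<in>ob B. F (G y) = y"
    by (auto simp: qcat_iso_def)
  have F: "F x \<in> ob B" if "x \<in> ob A" for x using * that by (auto simp: qfunctor_def)
  have G: "G x \<in> ob A" if "x \<in> ob B" for x using * that by (auto simp: qfunctor_def)
  have "bij_betw F (ob A) (ob B)"
    by (rule bij_betwI[where g = G]) (use * F G in auto)
  moreover have "hom B (F x) (F y) = hom A x y" if "x \<in> ob A" "y \<in> ob A" for x y
  proof (rule antisym)
    show "hom B (F x) (F y) \<le> hom A x y"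
      using *(4,5) F that unfolding qfunctor_def by metis
    show "hom A x y \<le> hom B (F x) (F y)"
      using *(3) that unfolding qfunctor_def by metis
  qed
  ultimately show ?R using * by simp
next
  assume R: ?R
  let ?G = "inv_into (ob A) F"
  have bij: "bij_betw F (ob A) (ob B)"
    and hom: "\<And>x y. x \<in> ob A \<Longrightarrow> y \<in> ob A \<Longrightarrow> hom B (F x) (F y) = hom A x y"
    using R by simp_all
  have F: "F x \<in> ob B" "?G (F x) = x" if "x \<in> ob A" for x
    using bij_betwE[OF bij] bij_betw_inv_into_left[OF bij] that by simp_all
  have G: "?G y \<in> ob A" "F (?G y) = y" if "y \<in> ob B" for y
    using bij_betwE[OF bij_betw_inv_into[OF bij]] bij_betw_inv_into_right[OF bij] that by simp_all
  have "qfunctor A B F"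
    by (simp add: qfunctor_def F hom)
  moreover have "hom A (?G x) (?G y) = hom B x y" if "x \<in> ob B" "y \<in> ob B" for x y
    using hom[OF G(1)[OF that(1)] G(1)[OF that(2)]] by (simp add: G(2) that)
  then have "qfunctor B A ?G"
    by (simp add: qfunctor_def G)
  ultimately show ?L
    unfolding qcat_iso_def using R F(2) G(2) by blast
qed

text \<open>The inverse is both a right and a left adjoint, so an isomorphism of Q-categories and
  its inverse are both arrows of Q-Sup.\<close>

lemma qcat_iso_adjoint:
  assumes "qcat_iso A B F"
  shows "qadjoint A B F (inv_into (ob A) F)" "qadjoint B A (inv_into (ob A) F) F"
proof -
  have *: "bij_betw F (ob A) (ob B)" and AB: "qcategory A" "qcategory B"
    and hom: "\<And>x y. x \<in> ob A \<Longrightarrow> y \<in> ob A \<Longrightarrow> hom B (F x) (F y) = hom A x y"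
    using assms by (simp_all add: qcat_iso_iff)
  have F: "F \<in> ob A \<rightarrow> ob B" and G: "inv_into (ob A) F \<in> ob B \<rightarrow> ob A"
    using bij_betwE[OF *] bij_betwE[OF bij_betw_inv_into[OF *]] by auto
  have FG: "F (inv_into (ob A) F y) = y" if "y \<in> ob B" for y
    using bij_betw_inv_into_right[OF *] that by simp
  show "qadjoint A B F (inv_into (ob A) F)"
    using AB F G by (rule qadjointI) (metis FG G PiE hom)
  show "qadjoint B A (inv_into (ob A) F) F"
    using AB(2,1) G F by (rule qadjointI) (metis FG G PiE hom)
qed

lemma skeletal_qcat_iso:
  assumes "qcat_iso A B F" "skeletal B"
  shows "skeletal A"
proof -
  have "bij_betw F (ob A) (ob B)" using assms by (simp add: qcat_iso_iff)
  then have "inj_on F (ob A)" "\<And>x. x \<in> ob A \<Longrightarrow> F x \<in> ob B"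
    by (auto simp: bij_betw_def)
  then show ?thesis
    using assms unfolding skeletal_def qcat_iso_iff by (metis inj_onD)
qed

text \<open>A presheaf on \<open>A\<close> is moved to \<open>B\<close> by precomposition with the
  inverse, its colimit is taken there, and the inverse image of that object is the colimit in
  \<open>A\<close>.\<close>

lemma cocomplete_qcat_iso:
  assumes iso: "qcat_iso A B F" and B: "cocomplete B"
  shows "cocomplete A"
proof -
  let ?G = "inv_into (ob A) F"
  have *: "bij_betw F (ob A) (ob B)" and AB: "qcategory A" "qcategory B"
    and hom: "\<And>x y. x \<in> ob A \<Longrightarrow> y \<in> ob A \<Longrightarrow> hom B (F x) (F y) = hom A x y"
    using iso by (simp_all add: qcat_iso_iff)
  have G: "?G y \<in> ob A" and FG: "F (?G y) = y" if "y \<in> ob B" for y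
    using bij_betwE[OF bij_betw_inv_into[OF *]] bij_betw_inv_into_right[OF *] that by auto
  have F: "F x \<in> ob B" and GF: "?G (F x) = x" if "x \<in> ob A" for x
    using bij_betwE[OF *] bij_betw_inv_into_left[OF *] that by auto
  have homG: "hom A (?G x) (?G y) = hom B x y" if "x \<in> ob B" "y \<in> ob B" for x y
    using hom[OF G[OF that(1)] G[OF that(2)]] that by (simp add: FG)
  have "\<exists>c\<in>ob A. \<forall>y\<in>ob A. hom A c y = (INF x\<in>ob A. \<mu> x \<rightarrow>\<^sub>Q hom A x y)"
    if \<mu>: "\<mu> \<in> ob (presheaves A)" for \<mu>
  proof -
    let ?\<nu> = "\<lambda>b\<in>ob B. \<mu> (?G b)"
    have "?\<nu> y * hom B x y \<le> ?\<nu> x" if "x \<in> ob B" "y \<in> ob B" for x y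
    proof -
      have "\<mu> (?G y) * hom A (?G x) (?G y) \<le> \<mu> (?G x)"
        using \<mu> G that by (simp add: presheaves_def)
      then show ?thesis using that by (simp add: homG)
    qed
    then have "?\<nu> \<in> ob (presheaves B)"
      by (simp add: presheaves_def)
    then obtain c where c: "c \<in> ob B"
      and hc: "\<And>y. y \<in> ob B \<Longrightarrow> hom B c y = (INF x\<in>ob B. ?\<nu> x \<rightarrow>\<^sub>Q hom B x y)"
      using B cocomplete_iff_colimits[OF AB(2)] by blast
    have "hom A (?G c) y = (INF x\<in>ob A. \<mu> x \<rightarrow>\<^sub>Q hom A x y)" if y: "y \<in> ob A" for y
    proof -
      have "hom A (?G c) y = hom B c (F y)"
        using hom[of "?G c" y] c y by (simp add: G FG)
      \<comment> \<open>Writing \<open>ob B\<close> as the image of \<open>F\<close> reindexes the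
        infimum over \<open>ob A\<close>, where the inverse cancels.\<close>
      also have "\<dots> = (INF x\<in>F ` ob A. ?\<nu> x \<rightarrow>\<^sub>Q hom B x (F y))"
        using hc[OF F[OF y]] bij_betw_imp_surj_on[OF *] by simp
      also have "\<dots> = (INF x\<in>ob A. \<mu> x \<rightarrow>\<^sub>Q hom A x y)"
        unfolding image_image by (rule INF_cong) (use y F GF hom in auto)
      finally show ?thesis .
    qed
    then show ?thesis using G[OF c] by blast
  qed
  then show ?thesis using cocomplete_iff_colimits[OF AB(1)] by blast
qed

section \<open>Left adjoint Q-functors and the category Q-Sup\<close>

lemma qadjointD:
  assumes "qadjoint A B F G"
  shows "x \<in> ob A \<Longrightarrow> F x \<in> ob B" "y \<in> ob B \<Longrightarrow> G y \<in> ob A"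
    and "x \<in> ob A \<Longrightarrow> x' \<in> ob A \<Longrightarrow> hom A x x' \<le> hom B (F x) (F x')"
    and "y \<in> ob B \<Longrightarrow> y' \<in> ob B \<Longrightarrow> hom B y y' \<le> hom A (G y) (G y')"
    and "x \<in> ob A \<Longrightarrow> y \<in> ob B \<Longrightarrow> hom B (F x) y = hom A x (G y)"
  using assms unfolding qadjoint_def qfunctor_def Pi_iff by blast+

lemma qadjoint_compose:
  assumes 1: "qadjoint A B F G" and 2: "qadjoint B C F' G'"
  shows "qadjoint A C (F' \<circ> F) (G \<circ> G')"
proof -
  note D1 = qadjointD(1,2)[OF 1] and D2 = qadjointD(1,2)[OF 2]
  have "hom A x y \<le> hom C (F' (F x)) (F' (F y))" if "x \<in> ob A" "y \<in> ob A" for x y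
    using order_trans[OF qadjointD(3)[OF 1 that] qadjointD(3)[OF 2]] that D1 by simp
  moreover have "hom C x y \<le> hom A (G (G' x)) (G (G' y))" if "x \<in> ob C" "y \<in> ob C" for x y
    using order_trans[OF qadjointD(4)[OF 2 that] qadjointD(4)[OF 1]] that D2 by simp
  moreover have "hom C (F' (F x)) y = hom A x (G (G' y))" if "x \<in> ob A" "y \<in> ob C" for x y
    using qadjointD(5)[OF 2, of "F x" y] qadjointD(5)[OF 1, of x "G' y"] that D1 D2 by simp
  ultimately show ?thesis
    using D1 D2 by (simp add: qadjoint_def qfunctor_def Pi_iff)
qed

lemma qadjoint_cong:
  assumes F: "\<And>x. x \<in> ob A \<Longrightarrow> F x = F' x" and FG: "qadjoint A B F G"
  shows "qadjoint A B F' G"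
proof -
  have "hom A x y \<le> hom B (F' x) (F' y)" if "x \<in> ob A" "y \<in> ob A" for x y
    using qadjointD(3)[OF FG that] by (simp add: F that)
  moreover have "F' x \<in> ob B" if "x \<in> ob A" for x
    using qadjointD(1)[OF FG that] by (simp add: F that)
  moreover have "hom B (F' x) y = hom A x (G y)" if "x \<in> ob A" "y \<in> ob B" for x y
    using qadjointD(5)[OF FG that] by (simp add: F that)
  ultimately show ?thesis
    using qadjointD(2,4)[OF FG] by (simp add: qadjoint_def qfunctor_def Pi_iff)
qed

lemma qadjoint_restrict:
  "qadjoint A B F G \<Longrightarrow> qadjoint A B (restrict F (ob A)) G"
  by (erule qadjoint_cong[rotated]) simp

text \<open>Arrows of Q-Sup are extensional maps, whereas adjunctions only see values on objects;
  restricting turns any left adjoint into an arrow.\<close>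

lemma qsup_arr_restrict:
  "qadjoint A B F G \<Longrightarrow> restrict F (ob A) \<in> qsup_arr A B"
  unfolding qsup_arr_def using qadjoint_restrict by blast

lemma qsup_arr_mapsto: "F \<in> qsup_arr A B \<Longrightarrow> x \<in> ob A \<Longrightarrow> F x \<in> ob B"
  by (auto simp: qsup_arr_def qadjoint_def qfunctor_def)

lemma qsup_arr_compose:
  assumes "F \<in> qsup_arr A B" "G \<in> qsup_arr B C"
  shows "compose (ob A) G F \<in> qsup_arr A C"
proof -
  obtain F' G' where "qadjoint A B F F'" "qadjoint B C G G'"
    using assms by (auto simp: qsup_arr_def)
  from qsup_arr_restrict[OF qadjoint_compose[OF this]] show ?thesis
    by (simp add: compose_def o_def)
qed

lemma qadjoint_id: "qadjoint A A (\<lambda>x. x) (\<lambda>x. x)"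
  by (simp add: qadjoint_def qfunctor_def)

lemma is_category_QSup: "is_category (QSup :: (('a, 'q::comm_unital_quantale) qcat, 'a \<Rightarrow> 'a) cat)"
  unfolding is_category_def QSup_def cat.simps
proof (intro conjI ballI)
  fix A :: "('a, 'q) qcat"
  show "(\<lambda>x\<in>ob A. x) \<in> qsup_arr A A"
    by (rule qsup_arr_restrict[OF qadjoint_id])
next
  fix A B :: "('a, 'q) qcat" and F
  assume F: "F \<in> qsup_arr A B"
  then have "F \<in> extensional (ob A)" by (simp add: qsup_arr_def)
  then show "compose (ob A) F (\<lambda>x\<in>ob A. x) = F" "compose (ob A) (\<lambda>x\<in>ob B. x) F = F"
    by (auto simp: compose_def fun_eq_iff extensional_def qsup_arr_mapsto[OF F])
next
  fix A B C D :: "('a, 'q) qcat" and F G H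
  assume F: "F \<in> qsup_arr A B" and "G \<in> qsup_arr B C" "H \<in> qsup_arr C D"
  show "compose (ob A) H (compose (ob A) G F) = compose (ob A) (compose (ob B) H G) F"
    by (simp add: compose_def fun_eq_iff qsup_arr_mapsto[OF F])
next
  fix A B C :: "('a, 'q) qcat" and F G
  assume "F \<in> qsup_arr A B" "G \<in> qsup_arr B C"
  then show "compose (ob A) G F \<in> qsup_arr A C"
    by (rule qsup_arr_compose)
qed

lemma qcat_iso_imp_qsup_iso:
  assumes iso: "qcat_iso A B F" and ext: "F \<in> extensional (ob A)"
  shows "qsup_iso A B F"
proof -
  let ?G = "restrict (inv_into (ob A) F) (ob B)"
  have bij: "bij_betw F (ob A) (ob B)" using iso by (simp add: qcat_iso_iff)
  have "F \<in> qsup_arr A B" "?G \<in> qsup_arr B A"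
    using qcat_iso_adjoint[OF iso] ext qsup_arr_restrict by (auto simp: qsup_arr_def)
  moreover have "\<forall>x\<in>ob A. ?G (F x) = x" "\<forall>y\<in>ob B. F (?G y) = y"
    using bij_betwE[OF bij]
    by (simp_all add: bij_betw_inv_into_left[OF bij] bij_betw_inv_into_right[OF bij])
  ultimately show ?thesis unfolding qsup_iso_def by (intro conjI bexI[of _ ?G])
qed

text \<open>The arrow map is conjugation, \<open>\<psi> b \<circ> Gm a b f \<circ> \<phi> a\<close>
  with \<psi> inverse to \<phi>. In a composite the inner \<phi> and \<psi> cancel, which gives
  functoriality; the outer cancellation gives naturality. Skeletality and cocompleteness of
  \<open>Fo a\<close> are inherited from \<open>Go a\<close>.\<close>

lemma qsup_functor_transport:
  fixes Fo :: "'o \<Rightarrow> ('a, 'q::comm_unital_quantale) qcat" and Go :: "'o \<Rightarrow> ('b, 'q) qcat"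
  assumes G: "is_functor C QSup Go Gm"
    and iso: "\<And>a. a \<in> Obj C \<Longrightarrow> qcat_iso (Fo a) (Go a) (\<phi> a)"
    and ext: "\<And>a. a \<in> Obj C \<Longrightarrow> \<phi> a \<in> extensional (ob (Fo a))"
  shows "\<exists>Fm. qsup_nat_iso C Fo Fm Go Gm \<phi>"
proof -
  define \<psi> where "\<psi> a = inv_into (ob (Fo a)) (\<phi> a)" for a
  define Fm where "Fm a b f = restrict (\<psi> b \<circ> (Gm a b f \<circ> \<phi> a)) (ob (Fo a))" for a b f
  have bij: "bij_betw (\<phi> a) (ob (Fo a)) (ob (Go a))" if "a \<in> Obj C" for a
    using iso[OF that] by (simp add: qcat_iso_iff)
  have \<phi>: "\<phi> a x \<in> ob (Go a)" and \<psi>\<phi>: "\<psi> a (\<phi> a x) = x" if "a \<in> Obj C" "x \<in> ob (Fo a)" for a x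
    using bij_betwE[OF bij] bij_betw_inv_into_left[OF bij] that by (auto simp: \<psi>_def)
  have \<psi>: "\<psi> a y \<in> ob (Fo a)" and \<phi>\<psi>: "\<phi> a (\<psi> a y) = y" if "a \<in> Obj C" "y \<in> ob (Go a)" for a y
    using bij_betwE[OF bij_betw_inv_into[OF bij]] bij_betw_inv_into_right[OF bij] that
    by (auto simp: \<psi>_def)
  have C: "is_category C"
    and Gob: "\<And>a. a \<in> Obj C \<Longrightarrow> qcategory (Go a) \<and> skeletal (Go a) \<and> cocomplete (Go a)"
    and Garr: "\<And>a b f. a \<in> Obj C \<Longrightarrow> b \<in> Obj C \<Longrightarrow> f \<in> Arr C a b \<Longrightarrow> Gm a b f \<in> qsup_arr (Go a) (Go b)"
    and Gid: "\<And>a. a \<in> Obj C \<Longrightarrow> Gm a a (Ident C a) = (\<lambda>x\<in>ob (Go a). x)"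
    and Gcomp: "\<And>a b c f g. a \<in> Obj C \<Longrightarrow> b \<in> Obj C \<Longrightarrow> c \<in> Obj C \<Longrightarrow> f \<in> Arr C a b \<Longrightarrow>
      g \<in> Arr C b c \<Longrightarrow> Gm a c (Comp C a b c g f) = compose (ob (Go a)) (Gm b c g) (Gm a b f)"
    using G by (auto simp: is_functor_def QSup_def)
  note Gmap = qsup_arr_mapsto[OF Garr]
  have "Fo a \<in> Obj QSup" if "a \<in> Obj C" for a
    using skeletal_qcat_iso[OF iso[OF that]] cocomplete_qcat_iso[OF iso[OF that]] Gob[OF that]
      iso[OF that]
    by (simp add: QSup_def qcat_iso_def)
  moreover have "Fm a b f \<in> Arr QSup (Fo a) (Fo b)"
    if abf: "a \<in> Obj C" "b \<in> Obj C" "f \<in> Arr C a b" for a b f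
  proof -
    obtain R where "qadjoint (Go a) (Go b) (Gm a b f) R"
      using Garr[OF abf] by (auto simp: qsup_arr_def)
    \<comment> \<open>All three factors of the conjugate are left adjoints: the isomorphism, the
      given arrow, and the inverse isomorphism.\<close>
    from qadjoint_compose[OF qadjoint_compose[OF qcat_iso_adjoint(1)[OF iso[OF abf(1)]] this]
        qcat_iso_adjoint(2)[OF iso[OF abf(2)]]]
    show ?thesis
      unfolding QSup_def cat.simps Fm_def \<psi>_def by (rule qsup_arr_restrict)
  qed
  moreover have "Fm a a (Ident C a) = Ident QSup (Fo a)" if "a \<in> Obj C" for a
    using that by (auto simp: Fm_def Gid QSup_def \<phi> \<psi>\<phi>)
  moreover have "Fm a c (Comp C a b c g f) = Comp QSup (Fo a) (Fo b) (Fo c) (Fm b c g) (Fm a b f)"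
    if "a \<in> Obj C" "b \<in> Obj C" "c \<in> Obj C" "f \<in> Arr C a b" "g \<in> Arr C b c" for a b c f g
    using that by (auto simp: Fm_def Gcomp QSup_def compose_def \<phi> \<psi> \<phi>\<psi> Gmap fun_eq_iff)
  ultimately have "is_functor C QSup Fo Fm"
    unfolding is_functor_def using C is_category_QSup by blast
  moreover have "\<phi> b (Fm a b f x) = Gm a b f (\<phi> a x)"
    if "a \<in> Obj C" "b \<in> Obj C" "f \<in> Arr C a b" "x \<in> ob (Fo a)" for a b f x
    using that by (simp add: Fm_def \<phi> \<phi>\<psi> Gmap)
  ultimately have "qsup_nat_iso C Fo Fm Go Gm \<phi>"
    unfolding qsup_nat_iso_def
    using G qcat_iso_imp_qsup_iso[OF iso ext] by blast
  then show ?thesis by blast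
qed

section \<open>The calculus of Q-relations\<close>

lemma Rel_sets: "\<alpha> \<in> Rel X Y \<Longrightarrow> src \<alpha> = X" "\<alpha> \<in> Rel X Y \<Longrightarrow> tgt \<alpha> = Y"
  by (simp_all add: Rel_def)

lemma Rel_eqI:
  assumes "\<alpha> \<in> Rel X Y" "\<beta> \<in> Rel X Y"
    and "\<And>x y. x \<in> X \<Longrightarrow> y \<in> Y \<Longrightarrow> val \<alpha> (x, y) = val \<beta> (x, y)"
  shows "\<alpha> = \<beta>"
proof -
  have "val \<alpha> = val \<beta>"
    by (rule extensionalityI[of _ "X \<times> Y"]) (use assms in \<open>auto simp: Rel_def\<close>)
  then show ?thesis using assms(1,2) by (simp add: Rel_def)
qed

lemma rcomp_Rel: "\<alpha> \<in> Rel X Y \<Longrightarrow> \<beta> \<in> Rel Y Z \<Longrightarrow> \<beta> \<circ>\<^sub>Q \<alpha> \<in> Rel X Z"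
  by (simp add: Rel_def rcomp_def)

lemma res_sw_Rel: "\<alpha> \<in> Rel X Y \<Longrightarrow> \<gamma> \<in> Rel X Z \<Longrightarrow> \<gamma> \<Down>\<^sub>Q \<alpha> \<in> Rel Y Z"
  by (simp add: Rel_def res_sw_def)

lemma res_se_Rel: "\<beta> \<in> Rel Y Z \<Longrightarrow> \<gamma> \<in> Rel X Z \<Longrightarrow> \<beta> \<Rrightarrow>\<^sub>Q \<gamma> \<in> Rel X Y"
  by (simp add: Rel_def res_se_def)

lemma scal_Rel: "\<alpha> \<in> Rel X Y \<Longrightarrow> scal q \<alpha> \<in> Rel X Y"
  by (simp add: Rel_def scal_def)

lemma star_k_Rel: "star_k s \<in> Rel {s} {s}"
  by (simp add: Rel_def star_k_def)

lemma val_rcomp: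
  assumes "\<alpha> \<in> Rel X Y" "\<beta> \<in> Rel Y Z" "x \<in> X" "z \<in> Z"
  shows "val (\<beta> \<circ>\<^sub>Q \<alpha>) (x, z) = (SUP y\<in>Y. val \<beta> (y, z) * val \<alpha> (x, y))"
  using assms by (simp add: Rel_def rcomp_def)

lemma val_res_sw:
  assumes "\<alpha> \<in> Rel X Y" "\<gamma> \<in> Rel X Z" "y \<in> Y" "z \<in> Z"
  shows "val (\<gamma> \<Down>\<^sub>Q \<alpha>) (y, z) = (INF x\<in>X. val \<alpha> (x, y) \<rightarrow>\<^sub>Q val \<gamma> (x, z))"
  using assms by (simp add: Rel_def res_sw_def)

lemma val_res_se:
  assumes "\<beta> \<in> Rel Y Z" "\<gamma> \<in> Rel X Z" "x \<in> X" "y \<in> Y"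
  shows "val (\<beta> \<Rrightarrow>\<^sub>Q \<gamma>) (x, y) = (INF z\<in>Z. val \<beta> (y, z) \<rightarrow>\<^sub>Q val \<gamma> (x, z))"
  using assms by (simp add: Rel_def res_se_def)

lemma val_scal:
  assumes "\<alpha> \<in> Rel X Y" "x \<in> X" "y \<in> Y"
  shows "val (scal q \<alpha>) (x, y) = q * val \<alpha> (x, y)"
  using assms by (simp add: Rel_def scal_def)

lemma rel_le_iff:
  "\<alpha> \<in> Rel X Y \<Longrightarrow> rel_le \<alpha> \<beta> \<longleftrightarrow> (\<forall>x\<in>X. \<forall>y\<in>Y. val \<alpha> (x, y) \<le> val \<beta> (x, y))"
  by (simp add: Rel_def rel_le_def)

lemma rel_le_refl: "rel_le \<alpha> \<alpha>"
  by (simp add: rel_le_def)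

lemma rel_le_trans:
  assumes "\<alpha> \<in> Rel X Y" "\<beta> \<in> Rel X Y" "rel_le \<alpha> \<beta>" "rel_le \<beta> \<gamma>"
  shows "rel_le \<alpha> \<gamma>"
proof -
  have "val \<alpha> (x, y) \<le> val \<gamma> (x, y)" if "x \<in> X" "y \<in> Y" for x y
    using assms(3,4) that order_trans[of "val \<alpha> (x, y)" "val \<beta> (x, y)"]
    by (simp add: rel_le_iff[OF assms(1)] rel_le_iff[OF assms(2)])
  then show ?thesis by (simp add: rel_le_iff[OF assms(1)])
qed

lemma rel_le_antisym:
  assumes "\<alpha> \<in> Rel X Y" "\<beta> \<in> Rel X Y" "rel_le \<alpha> \<beta>" "rel_le \<beta> \<alpha>"
  shows "\<alpha> = \<beta>"
  using assms(1,2)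
proof (rule Rel_eqI)
  fix x y assume "x \<in> X" "y \<in> Y"
  then show "val \<alpha> (x, y) = val \<beta> (x, y)"
    using assms(3,4) by (intro antisym) (simp_all add: rel_le_iff[OF assms(1)] rel_le_iff[OF assms(2)])
qed

text \<open>Distributivity turns both sides into double joins of the same triple products, and the
  two joins are exchanged.\<close>

lemma rcomp_assoc:
  assumes \<alpha>: "\<alpha> \<in> Rel X Y" and \<beta>: "\<beta> \<in> Rel Y Z" and \<gamma>: "\<gamma> \<in> Rel Z W"
  shows "(\<gamma> \<circ>\<^sub>Q \<beta>) \<circ>\<^sub>Q \<alpha> = \<gamma> \<circ>\<^sub>Q (\<beta> \<circ>\<^sub>Q \<alpha>)"
proof (rule Rel_eqI)
  show "(\<gamma> \<circ>\<^sub>Q \<beta>) \<circ>\<^sub>Q \<alpha> \<in> Rel X W" "\<gamma> \<circ>\<^sub>Q (\<beta> \<circ>\<^sub>Q \<alpha>) \<in> Rel X W"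
    using assms by (blast intro: rcomp_Rel)+
next
  fix x w assume x: "x \<in> X" and w: "w \<in> W"
  have "val ((\<gamma> \<circ>\<^sub>Q \<beta>) \<circ>\<^sub>Q \<alpha>) (x, w) =
      (SUP y\<in>Y. SUP z\<in>Z. val \<gamma> (z, w) * val \<beta> (y, z) * val \<alpha> (x, y))"
    using x w by (simp add: val_rcomp[OF \<alpha> rcomp_Rel[OF \<beta> \<gamma>]] val_rcomp[OF \<beta> \<gamma>] quantale_SUP_mult)
  also have "\<dots> = (SUP z\<in>Z. SUP y\<in>Y. val \<gamma> (z, w) * val \<beta> (y, z) * val \<alpha> (x, y))"
    by (rule SUP_commute)
  also have "\<dots> = val (\<gamma> \<circ>\<^sub>Q (\<beta> \<circ>\<^sub>Q \<alpha>)) (x, w)"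
    using x w by (simp add: val_rcomp[OF rcomp_Rel[OF \<alpha> \<beta>] \<gamma>] val_rcomp[OF \<alpha> \<beta>] quantale_mult_SUP mult.assoc)
  finally show "val ((\<gamma> \<circ>\<^sub>Q \<beta>) \<circ>\<^sub>Q \<alpha>) (x, w) = val (\<gamma> \<circ>\<^sub>Q (\<beta> \<circ>\<^sub>Q \<alpha>)) (x, w)" .
qed

section \<open>Residuation: composition and its two right adjoints\<close>

lemma rel_le_rcomp_iff:
  assumes \<alpha>: "\<alpha> \<in> Rel X Y" and \<beta>: "\<beta> \<in> Rel Y Z"
  shows "rel_le (\<beta> \<circ>\<^sub>Q \<alpha>) \<gamma> \<longleftrightarrow>
    (\<forall>x\<in>X. \<forall>y\<in>Y. \<forall>z\<in>Z. val \<beta> (y, z) * val \<alpha> (x, y) \<le> val \<gamma> (x, z))"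
  by (auto simp: rel_le_iff[OF rcomp_Rel[OF \<alpha> \<beta>]] val_rcomp[OF \<alpha> \<beta>] SUP_le_iff)

text \<open>Both sides unfold to the same family of inequalities in Q, related entry by entry by the
  adjunction between \<open>*\<close> and \<open>\<rightarrow>\<^sub>Q\<close>.\<close>

lemma res_sw_adjoint:
  assumes \<alpha>: "\<alpha> \<in> Rel X Y" and \<beta>: "\<beta> \<in> Rel Y Z" and \<gamma>: "\<gamma> \<in> Rel X Z"
  shows "rel_le (\<beta> \<circ>\<^sub>Q \<alpha>) \<gamma> \<longleftrightarrow> rel_le \<beta> (\<gamma> \<Down>\<^sub>Q \<alpha>)"
  unfolding rel_le_rcomp_iff[OF \<alpha> \<beta>]
  by (auto simp: rel_le_iff[OF \<beta>] val_res_sw[OF \<alpha> \<gamma>] le_INF_iff mult.commute simp flip: qimp_adjoint)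

lemma res_se_adjoint:
  assumes \<alpha>: "\<alpha> \<in> Rel X Y" and \<beta>: "\<beta> \<in> Rel Y Z" and \<gamma>: "\<gamma> \<in> Rel X Z"
  shows "rel_le (\<beta> \<circ>\<^sub>Q \<alpha>) \<gamma> \<longleftrightarrow> rel_le \<alpha> (\<beta> \<Rrightarrow>\<^sub>Q \<gamma>)"
  unfolding rel_le_rcomp_iff[OF \<alpha> \<beta>]
  by (auto simp: rel_le_iff[OF \<alpha>] val_res_se[OF \<beta> \<gamma>] le_INF_iff simp flip: qimp_adjoint)

lemma rcomp_mono_left:
  assumes \<alpha>: "\<alpha> \<in> Rel X Y" and \<beta>: "\<beta> \<in> Rel Y Z" and \<beta>': "\<beta>' \<in> Rel Y Z" and "rel_le \<beta> \<beta>'"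
  shows "rel_le (\<beta> \<circ>\<^sub>Q \<alpha>) (\<beta>' \<circ>\<^sub>Q \<alpha>)"
proof -
  have "rel_le \<beta>' ((\<beta>' \<circ>\<^sub>Q \<alpha>) \<Down>\<^sub>Q \<alpha>)"
    using res_sw_adjoint[OF \<alpha> \<beta>' rcomp_Rel[OF \<alpha> \<beta>']] rel_le_refl by blast
  then have "rel_le \<beta> ((\<beta>' \<circ>\<^sub>Q \<alpha>) \<Down>\<^sub>Q \<alpha>)"
    by (rule rel_le_trans[OF \<beta> \<beta>' assms(4)])
  then show ?thesis using res_sw_adjoint[OF \<alpha> \<beta> rcomp_Rel[OF \<alpha> \<beta>']] by blast
qed

lemma rcomp_mono_right:
  assumes \<alpha>: "\<alpha> \<in> Rel X Y" and \<alpha>': "\<alpha>' \<in> Rel X Y" and \<beta>: "\<beta> \<in> Rel Y Z" and "rel_le \<alpha> \<alpha>'"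
  shows "rel_le (\<beta> \<circ>\<^sub>Q \<alpha>) (\<beta> \<circ>\<^sub>Q \<alpha>')"
proof -
  have "rel_le \<alpha>' (\<beta> \<Rrightarrow>\<^sub>Q (\<beta> \<circ>\<^sub>Q \<alpha>'))"
    using res_se_adjoint[OF \<alpha>' \<beta> rcomp_Rel[OF \<alpha>' \<beta>]] rel_le_refl by blast
  then have "rel_le \<alpha> (\<beta> \<Rrightarrow>\<^sub>Q (\<beta> \<circ>\<^sub>Q \<alpha>'))"
    by (rule rel_le_trans[OF \<alpha> \<alpha>' assms(4)])
  then show ?thesis using res_se_adjoint[OF \<alpha> \<beta> rcomp_Rel[OF \<alpha>' \<beta>]] by blast
qed

lemma res_sw_counit:
  assumes \<alpha>: "\<alpha> \<in> Rel X Y" and \<gamma>: "\<gamma> \<in> Rel X Z"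
  shows "rel_le ((\<gamma> \<Down>\<^sub>Q \<alpha>) \<circ>\<^sub>Q \<alpha>) \<gamma>"
  using res_sw_adjoint[OF \<alpha> res_sw_Rel[OF \<alpha> \<gamma>] \<gamma>] rel_le_refl by blast

lemma res_se_counit:
  assumes \<beta>: "\<beta> \<in> Rel Y Z" and \<gamma>: "\<gamma> \<in> Rel X Z"
  shows "rel_le (\<beta> \<circ>\<^sub>Q (\<beta> \<Rrightarrow>\<^sub>Q \<gamma>)) \<gamma>"
  using res_se_adjoint[OF res_se_Rel[OF \<beta> \<gamma>] \<beta> \<gamma>] rel_le_refl by blast

text \<open>A triangle identity of the adjunction: one inequality is the counit, the other is the
  unit composed with \<alpha>. Hence whatever factors through \<alpha> is a fixed point of the
  associated interior operator.\<close>

lemma rcomp_res_sw_rcomp: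
  assumes \<alpha>: "\<alpha> \<in> Rel X Y" and v: "v \<in> Rel Y Z"
  shows "((v \<circ>\<^sub>Q \<alpha>) \<Down>\<^sub>Q \<alpha>) \<circ>\<^sub>Q \<alpha> = v \<circ>\<^sub>Q \<alpha>"
proof -
  note f = rcomp_Rel[OF \<alpha> v]
  note r = res_sw_Rel[OF \<alpha> f]
  have "rel_le v ((v \<circ>\<^sub>Q \<alpha>) \<Down>\<^sub>Q \<alpha>)"
    using res_sw_adjoint[OF \<alpha> v f] rel_le_refl by blast
  from rcomp_mono_left[OF \<alpha> v r this] show ?thesis
    by (rule rel_le_antisym[OF rcomp_Rel[OF \<alpha> r] f res_sw_counit[OF \<alpha> f]])
qed

lemma rcomp_res_se_rcomp:
  assumes \<beta>: "\<beta> \<in> Rel Y Z" and u: "u \<in> Rel X Y"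
  shows "\<beta> \<circ>\<^sub>Q (\<beta> \<Rrightarrow>\<^sub>Q (\<beta> \<circ>\<^sub>Q u)) = \<beta> \<circ>\<^sub>Q u"
proof -
  note f = rcomp_Rel[OF u \<beta>]
  note r = res_se_Rel[OF \<beta> f]
  have "rel_le u (\<beta> \<Rrightarrow>\<^sub>Q (\<beta> \<circ>\<^sub>Q u))"
    using res_se_adjoint[OF u \<beta> f] rel_le_refl by blast
  from rcomp_mono_right[OF u r \<beta> this] show ?thesis
    by (rule rel_le_antisym[OF rcomp_Rel[OF r \<beta>] f res_se_counit[OF \<beta> f]])
qed

section \<open>The Q-valued hom induced by the scalar action on Q-relations\<close>

definition rel_hom :: "('x, 'y, 'q::comm_unital_quantale) qrel \<Rightarrow> ('x, 'y, 'q) qrel \<Rightarrow> 'q" where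
  "rel_hom f g = Sup {q. rel_le (scal q f) g}"

text \<open>The scalars \<open>q\<close> with \<open>rel_le (scal q f) g\<close> are exactly those
  below the infimum of the implications between entries, so the supremum defining
  \<open>rel_hom\<close> is attained.\<close>

lemma le_rel_hom_iff:
  assumes f: "f \<in> Rel X Y"
  shows "q \<le> rel_hom f g \<longleftrightarrow> rel_le (scal q f) g"
proof -
  have *: "rel_le (scal q f) g \<longleftrightarrow> q \<le> (INF x\<in>X. INF y\<in>Y. val f (x, y) \<rightarrow>\<^sub>Q val g (x, y))" for q
    by (simp add: rel_le_iff[OF scal_Rel[OF f]] val_scal[OF f] le_INF_iff mult.commute
        flip: qimp_adjoint)
  have "rel_hom f g = Sup {q. q \<le> (INF x\<in>X. INF y\<in>Y. val f (x, y) \<rightarrow>\<^sub>Q val g (x, y))}"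
    by (simp add: rel_hom_def *)
  also have "\<dots> = (INF x\<in>X. INF y\<in>Y. val f (x, y) \<rightarrow>\<^sub>Q val g (x, y))"
    by (rule antisym) (auto intro: Sup_least Sup_upper)
  finally show ?thesis by (simp add: *)
qed

text \<open>Used to prove equality of two homs by comparing the scalars below them.\<close>

lemma lower_set_eqI: "(\<And>q. q \<le> a \<longleftrightarrow> q \<le> b) \<Longrightarrow> a = (b :: 'a::order)"
  by (meson antisym order_refl)

lemma scal_1:
  assumes f: "f \<in> Rel X Y"
  shows "scal 1 f = f"
  by (rule Rel_eqI[OF scal_Rel[OF f] f]) (simp add: val_scal[OF f])

lemma scal_mult:
  assumes f: "f \<in> Rel X Y"
  shows "scal (p * q) f = scal p (scal q f)"
  by (rule Rel_eqI[OF scal_Rel[OF f] scal_Rel[OF scal_Rel[OF f]]])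
    (simp add: val_scal[OF scal_Rel[OF f]] val_scal[OF f] mult.assoc)

lemma scal_rcomp:
  assumes \<alpha>: "\<alpha> \<in> Rel X Y" and \<beta>: "\<beta> \<in> Rel Y Z"
  shows "scal q (\<beta> \<circ>\<^sub>Q \<alpha>) = scal q \<beta> \<circ>\<^sub>Q \<alpha>"
  by (rule Rel_eqI[OF scal_Rel[OF rcomp_Rel[OF \<alpha> \<beta>]] rcomp_Rel[OF \<alpha> scal_Rel[OF \<beta>]]])
    (simp add: val_scal[OF rcomp_Rel[OF \<alpha> \<beta>]] val_rcomp[OF \<alpha> \<beta>] val_rcomp[OF \<alpha> scal_Rel[OF \<beta>]]
      val_scal[OF \<beta>] quantale_mult_SUP mult.assoc)

lemma scal_mono:
  assumes f: "f \<in> Rel X Y" and g: "g \<in> Rel X Y" and "rel_le f g"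
  shows "rel_le (scal q f) (scal q g)"
  using assms(3)
  by (simp add: rel_le_iff[OF scal_Rel[OF f]] rel_le_iff[OF f] val_scal[OF f] val_scal[OF g]
      quantale_mult_mono)

text \<open>Scaling commutes with composition by \<alpha>, so the order adjunction applied to every
  multiple of \<open>v\<close> becomes an adjunction of Q-valued homs.\<close>

lemma rel_hom_rcomp:
  assumes \<alpha>: "\<alpha> \<in> Rel X Y" and v: "v \<in> Rel Y Z" and g: "g \<in> Rel X Z"
  shows "rel_hom (v \<circ>\<^sub>Q \<alpha>) g = rel_hom v (g \<Down>\<^sub>Q \<alpha>)"
proof (rule lower_set_eqI)
  fix q
  show "q \<le> rel_hom (v \<circ>\<^sub>Q \<alpha>) g \<longleftrightarrow> q \<le> rel_hom v (g \<Down>\<^sub>Q \<alpha>)"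
    by (simp add: le_rel_hom_iff[OF rcomp_Rel[OF \<alpha> v]] le_rel_hom_iff[OF v] scal_rcomp[OF \<alpha> v]
        res_sw_adjoint[OF \<alpha> scal_Rel[OF v] g])
qed

lemma one_le_rel_hom_iff: "f \<in> Rel X Y \<Longrightarrow> 1 \<le> rel_hom f g \<longleftrightarrow> rel_le f g"
  by (simp add: le_rel_hom_iff scal_1)

text \<open>Scaling \<open>f\<close> by \<open>rel_hom f g\<close> lands below \<open>g\<close>;
  scaling again by \<open>rel_hom g h\<close> lands below \<open>h\<close>. So the product of the
  two scalars qualifies for \<open>rel_hom f h\<close>.\<close>

lemma rel_hom_trans:
  assumes f: "f \<in> Rel X Y" and g: "g \<in> Rel X Y"
  shows "rel_hom g h * rel_hom f g \<le> rel_hom f h"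
proof -
  have "rel_le (scal (rel_hom f g) f) g" "rel_le (scal (rel_hom g h) g) h"
    using le_rel_hom_iff[OF f] le_rel_hom_iff[OF g] by blast+
  then have "rel_le (scal (rel_hom g h) (scal (rel_hom f g) f)) h"
    using scal_mono[OF scal_Rel[OF f] g] rel_le_trans[OF scal_Rel[OF scal_Rel[OF f]] scal_Rel[OF g]]
    by blast
  then show ?thesis by (simp add: le_rel_hom_iff[OF f] scal_mult[OF f])
qed

text \<open>Links the hom coming from the Q-action, used in \<open>D_ob\<close>, with the residual
  used in \<open>concept_lattice\<close>: a scalar lies below either exactly if it multiplies each
  entry of \<open>f\<close> below that of \<open>g\<close>.\<close>

lemma rel_hom_singleton:
  assumes f: "f \<in> Rel Y {s}" and g: "g \<in> Rel Y {s}"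
  shows "rel_hom f g = val (g \<Down>\<^sub>Q f) (s, s)"
proof (rule lower_set_eqI)
  fix q
  show "q \<le> rel_hom f g \<longleftrightarrow> q \<le> val (g \<Down>\<^sub>Q f) (s, s)"
    by (simp add: le_rel_hom_iff[OF f] val_res_sw[OF f g] rel_le_iff[OF scal_Rel[OF f]] val_scal[OF f]
        le_INF_iff mult.commute flip: qimp_adjoint)
qed

section \<open>The diagonal category\<close>

text \<open>The residuals are themselves factors, and conversely the triangle identities turn any
  factorization into the required fixed point equation.\<close>

lemma dhom_iff:
  assumes \<alpha>: "\<alpha> \<in> Rel X Y" and \<beta>: "\<beta> \<in> Rel X' Y'"
  shows "f \<in> dhom \<alpha> \<beta> \<longleftrightarrow> (\<exists>v\<in>Rel Y Y'. f = v \<circ>\<^sub>Q \<alpha>) \<and> (\<exists>u\<in>Rel X X'. f = \<beta> \<circ>\<^sub>Q u)"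
proof
  assume "f \<in> dhom \<alpha> \<beta>"
  then have f: "f \<in> Rel X Y'" and "(f \<Down>\<^sub>Q \<alpha>) \<circ>\<^sub>Q \<alpha> = f" "f = \<beta> \<circ>\<^sub>Q (\<beta> \<Rrightarrow>\<^sub>Q f)"
    by (auto simp: dhom_def Rel_sets[OF \<alpha>] Rel_sets[OF \<beta>])
  then show "(\<exists>v\<in>Rel Y Y'. f = v \<circ>\<^sub>Q \<alpha>) \<and> (\<exists>u\<in>Rel X X'. f = \<beta> \<circ>\<^sub>Q u)"
    using res_sw_Rel[OF \<alpha> f] res_se_Rel[OF \<beta> f] by metis
next
  assume "(\<exists>v\<in>Rel Y Y'. f = v \<circ>\<^sub>Q \<alpha>) \<and> (\<exists>u\<in>Rel X X'. f = \<beta> \<circ>\<^sub>Q u)"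
  then obtain v u where v: "v \<in> Rel Y Y'" "f = v \<circ>\<^sub>Q \<alpha>" and u: "u \<in> Rel X X'" "f = \<beta> \<circ>\<^sub>Q u"
    by blast
  have "f \<in> Rel X Y'" using rcomp_Rel[OF \<alpha> v(1)] v(2) by simp
  moreover have "(f \<Down>\<^sub>Q \<alpha>) \<circ>\<^sub>Q \<alpha> = f" unfolding v(2) by (rule rcomp_res_sw_rcomp[OF \<alpha> v(1)])
  moreover have "\<beta> \<circ>\<^sub>Q (\<beta> \<Rrightarrow>\<^sub>Q f) = f" unfolding u(2) by (rule rcomp_res_se_rcomp[OF \<beta> u(1)])
  ultimately show "f \<in> dhom \<alpha> \<beta>"
    by (simp add: dhom_def Rel_sets[OF \<alpha>] Rel_sets[OF \<beta>])
qed

lemma dhomD: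
  assumes "f \<in> dhom \<alpha> \<beta>" "\<alpha> \<in> Rel X Y" "\<beta> \<in> Rel X' Y'"
  shows "f \<in> Rel X Y'" "(f \<Down>\<^sub>Q \<alpha>) \<circ>\<^sub>Q \<alpha> = f" "\<beta> \<circ>\<^sub>Q (\<beta> \<Rrightarrow>\<^sub>Q f) = f"
    "f \<Down>\<^sub>Q \<alpha> \<in> Rel Y Y'" "\<beta> \<Rrightarrow>\<^sub>Q f \<in> Rel X X'"
proof -
  show "f \<in> Rel X Y'" "(f \<Down>\<^sub>Q \<alpha>) \<circ>\<^sub>Q \<alpha> = f" "\<beta> \<circ>\<^sub>Q (\<beta> \<Rrightarrow>\<^sub>Q f) = f"
    using assms by (auto simp: dhom_def Rel_sets)
  then show "f \<Down>\<^sub>Q \<alpha> \<in> Rel Y Y'" "\<beta> \<Rrightarrow>\<^sub>Q f \<in> Rel X X'"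
    using assms(2,3) by (blast intro: res_sw_Rel res_se_Rel)+
qed

lemma dhom_comp:
  assumes \<alpha>: "\<alpha> \<in> Rel X Y" and \<beta>: "\<beta> \<in> Rel X' Y'" and \<gamma>: "\<gamma> \<in> Rel X'' Y''"
    and f: "f \<in> dhom \<alpha> \<beta>" and g: "g \<in> dhom \<beta> \<gamma>"
  shows "g \<circ>\<^sub>Q (\<beta> \<Rrightarrow>\<^sub>Q f) = (g \<Down>\<^sub>Q \<beta>) \<circ>\<^sub>Q f" "g \<circ>\<^sub>Q (\<beta> \<Rrightarrow>\<^sub>Q f) \<in> dhom \<alpha> \<gamma>"
proof -
  note F = dhomD[OF f \<alpha> \<beta>] and G = dhomD[OF g \<beta> \<gamma>]
  \<comment> \<open>Both expressions equal \<open>(g \<Down>\<^sub>Q \<beta>) \<circ>\<^sub>Q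
    \<beta> \<circ>\<^sub>Q (\<beta> \<Rrightarrow>\<^sub>Q f)\<close>. The right-hand form then
    exhibits a factor through \<alpha>, the left-hand form a factor through \<gamma>.\<close>
  show 1: "g \<circ>\<^sub>Q (\<beta> \<Rrightarrow>\<^sub>Q f) = (g \<Down>\<^sub>Q \<beta>) \<circ>\<^sub>Q f"
    using rcomp_assoc[OF F(5) \<beta> G(4)] F(3) G(2) by simp
  also have "\<dots> = ((g \<Down>\<^sub>Q \<beta>) \<circ>\<^sub>Q (f \<Down>\<^sub>Q \<alpha>)) \<circ>\<^sub>Q \<alpha>"
    using rcomp_assoc[OF \<alpha> F(4) G(4)] F(2) by simp
  finally have "g \<circ>\<^sub>Q (\<beta> \<Rrightarrow>\<^sub>Q f) = ((g \<Down>\<^sub>Q \<beta>) \<circ>\<^sub>Q (f \<Down>\<^sub>Q \<alpha>)) \<circ>\<^sub>Q \<alpha>" .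
  moreover have "g \<circ>\<^sub>Q (\<beta> \<Rrightarrow>\<^sub>Q f) = \<gamma> \<circ>\<^sub>Q ((\<gamma> \<Rrightarrow>\<^sub>Q g) \<circ>\<^sub>Q (\<beta> \<Rrightarrow>\<^sub>Q f))"
    using rcomp_assoc[OF F(5) G(5) \<gamma>] G(3) by simp
  ultimately show "g \<circ>\<^sub>Q (\<beta> \<Rrightarrow>\<^sub>Q f) \<in> dhom \<alpha> \<gamma>"
    unfolding dhom_iff[OF \<alpha> \<gamma>] using rcomp_Rel[OF F(4) G(4)] rcomp_Rel[OF F(5) G(5)] by blast
qed

section \<open>Identity Q-relations and the category axioms for diagonals\<close>

definition id_rel :: "'x set \<Rightarrow> ('x, 'x, 'q::comm_unital_quantale) qrel" where
  "id_rel X = \<lparr>src = X, tgt = X, val = (\<lambda>(x, y)\<in>X \<times> X. if x = y then 1 else bot)\<rparr>"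

lemma id_rel_Rel: "id_rel X \<in> Rel X X"
  by (simp add: id_rel_def Rel_def)

lemma val_id_rel:
  "x \<in> X \<Longrightarrow> y \<in> X \<Longrightarrow> val (id_rel X) (x, y) = (if x = y then 1 else bot)"
  by (simp add: id_rel_def)

lemma quantale_bot_mult: "bot * a = (bot :: 'q::comm_unital_quantale)"
  using quantale_SUP_mult[of "\<lambda>x. x" "{}" a] by simp

text \<open>Off the diagonal \<open>bot\<close> annihilates the product, so only the term at
  \<open>x\<close> contributes to the join.\<close>

lemma SUP_id_rel:
  fixes h :: "'x \<Rightarrow> 'q::comm_unital_quantale"
  assumes "x \<in> X"
  shows "(SUP y\<in>X. (if x = y then 1 else bot) * h y) = h x"
proof (rule antisym)
  show "(SUP y\<in>X. (if x = y then 1 else bot) * h y) \<le> h x"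
    by (rule SUP_least) (simp add: quantale_bot_mult)
  show "h x \<le> (SUP y\<in>X. (if x = y then 1 else bot) * h y)"
    by (rule SUP_upper2[OF assms]) simp
qed

lemma rcomp_id_rel:
  assumes \<alpha>: "\<alpha> \<in> Rel X Y"
  shows "\<alpha> \<circ>\<^sub>Q id_rel X = \<alpha>"
proof (rule Rel_eqI[OF rcomp_Rel[OF id_rel_Rel \<alpha>] \<alpha>])
  fix x y assume "x \<in> X" "y \<in> Y"
  then show "val (\<alpha> \<circ>\<^sub>Q id_rel X) (x, y) = val \<alpha> (x, y)"
    using SUP_id_rel[of x X "\<lambda>z. val \<alpha> (z, y)"]
    by (simp add: val_rcomp[OF id_rel_Rel \<alpha>] val_id_rel mult.commute cong: SUP_cong)
qed

lemma id_rel_rcomp: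
  assumes \<alpha>: "\<alpha> \<in> Rel X Y"
  shows "id_rel Y \<circ>\<^sub>Q \<alpha> = \<alpha>"
proof (rule Rel_eqI[OF rcomp_Rel[OF \<alpha> id_rel_Rel] \<alpha>])
  fix x y assume "x \<in> X" "y \<in> Y"
  then show "val (id_rel Y \<circ>\<^sub>Q \<alpha>) (x, y) = val \<alpha> (x, y)"
    using SUP_id_rel[of y Y "\<lambda>z. val \<alpha> (x, z)"]
    by (simp add: val_rcomp[OF \<alpha> id_rel_Rel] val_id_rel eq_commute[of _ y] cong: SUP_cong)
qed

lemma star_k_eq_id_rel: "star_k s = id_rel {s}"
  by (simp add: star_k_def id_rel_def fun_eq_iff)

lemma dhom_self:
  assumes \<alpha>: "\<alpha> \<in> Rel X Y"
  shows "\<alpha> \<in> dhom \<alpha> \<alpha>"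
  unfolding dhom_iff[OF \<alpha> \<alpha>]
  by (intro conjI bexI[of _ "id_rel X"] bexI[of _ "id_rel Y"])
    (simp_all add: rcomp_id_rel[OF \<alpha>] id_rel_rcomp[OF \<alpha>] id_rel_Rel)

lemma is_category_DRel: "is_category (DRel :: (('u, 'u, 'q::comm_unital_quantale) qrel, ('u, 'u, 'q) qrel) cat)"
  unfolding is_category_def DRel_def cat.simps mem_Collect_eq
proof (intro conjI ballI)
  fix \<alpha> :: "('u, 'u, 'q) qrel"
  assume "\<alpha> \<in> {\<alpha>. \<alpha> \<in> Rel (src \<alpha>) (tgt \<alpha>)}"
  then show "\<alpha> \<in> dhom \<alpha> \<alpha>" using dhom_self by blast
next
  fix \<alpha> \<beta> \<gamma> f g :: "('u, 'u, 'q) qrel"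
  assume "\<alpha> \<in> {\<alpha>. \<alpha> \<in> Rel (src \<alpha>) (tgt \<alpha>)}" "\<beta> \<in> {\<alpha>. \<alpha> \<in> Rel (src \<alpha>) (tgt \<alpha>)}"
    "\<gamma> \<in> {\<alpha>. \<alpha> \<in> Rel (src \<alpha>) (tgt \<alpha>)}" "f \<in> dhom \<alpha> \<beta>" "g \<in> dhom \<beta> \<gamma>"
  then show "g \<circ>\<^sub>Q (\<beta> \<Rrightarrow>\<^sub>Q f) \<in> dhom \<alpha> \<gamma>" using dhom_comp(2) by blast
next
  fix \<alpha> \<beta> f :: "('u, 'u, 'q) qrel"
  assume "\<alpha> \<in> {\<alpha>. \<alpha> \<in> Rel (src \<alpha>) (tgt \<alpha>)}" "\<beta> \<in> {\<alpha>. \<alpha> \<in> Rel (src \<alpha>) (tgt \<alpha>)}"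
    and f: "f \<in> dhom \<alpha> \<beta>"
  then have \<alpha>: "\<alpha> \<in> Rel (src \<alpha>) (tgt \<alpha>)" and \<beta>: "\<beta> \<in> Rel (src \<beta>) (tgt \<beta>)" by simp_all
  show "f \<circ>\<^sub>Q (\<alpha> \<Rrightarrow>\<^sub>Q \<alpha>) = f"
    \<comment> \<open>In its second form the composite with the identity \<alpha> is
      \<open>(f \<Down>\<^sub>Q \<alpha>) \<circ>\<^sub>Q \<alpha>\<close>, which is
      \<open>f\<close> because \<open>f\<close> is diagonal.\<close>
    using dhom_comp(1)[OF \<alpha> \<alpha> \<beta> dhom_self[OF \<alpha>] f] dhomD(2)[OF f \<alpha> \<beta>] by simp
  show "\<beta> \<circ>\<^sub>Q (\<beta> \<Rrightarrow>\<^sub>Q f) = f"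
    by (rule dhomD(3)[OF f \<alpha> \<beta>])
next
  fix \<alpha> \<beta> \<gamma> \<delta> f g h :: "('u, 'u, 'q) qrel"
  assume "\<alpha> \<in> {\<alpha>. \<alpha> \<in> Rel (src \<alpha>) (tgt \<alpha>)}" "\<beta> \<in> {\<alpha>. \<alpha> \<in> Rel (src \<alpha>) (tgt \<alpha>)}"
    "\<gamma> \<in> {\<alpha>. \<alpha> \<in> Rel (src \<alpha>) (tgt \<alpha>)}" "\<delta> \<in> {\<alpha>. \<alpha> \<in> Rel (src \<alpha>) (tgt \<alpha>)}"
    and f: "f \<in> dhom \<alpha> \<beta>" and g: "g \<in> dhom \<beta> \<gamma>" and h: "h \<in> dhom \<gamma> \<delta>"
  then have \<alpha>: "\<alpha> \<in> Rel (src \<alpha>) (tgt \<alpha>)" and \<beta>: "\<beta> \<in> Rel (src \<beta>) (tgt \<beta>)"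
    and \<gamma>: "\<gamma> \<in> Rel (src \<gamma>) (tgt \<gamma>)" and \<delta>: "\<delta> \<in> Rel (src \<delta>) (tgt \<delta>)" by simp_all
  \<comment> \<open>Rewriting the composites with \<open>h\<close> in the second form makes both
    sides bracketings of \<open>(h \<Down>\<^sub>Q \<gamma>) \<circ>\<^sub>Q g \<circ>\<^sub>Q
    (\<beta> \<Rrightarrow>\<^sub>Q f)\<close>.\<close>
  show "h \<circ>\<^sub>Q (\<gamma> \<Rrightarrow>\<^sub>Q (g \<circ>\<^sub>Q (\<beta> \<Rrightarrow>\<^sub>Q f))) = (h \<circ>\<^sub>Q (\<gamma> \<Rrightarrow>\<^sub>Q g)) \<circ>\<^sub>Q (\<beta> \<Rrightarrow>\<^sub>Q f)"
    using dhom_comp(1)[OF \<alpha> \<gamma> \<delta> dhom_comp(2)[OF \<alpha> \<beta> \<gamma> f g] h] dhom_comp(1)[OF \<beta> \<gamma> \<delta> g h]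
      rcomp_assoc[OF dhomD(5)[OF f \<alpha> \<beta>] dhomD(1)[OF g \<beta> \<gamma>] dhomD(4)[OF h \<gamma> \<delta>]]
    by simp
qed

section \<open>The representable functor\<close>

text \<open>\<open>star_k s\<close> is an identity Q-relation, so everything into \<open>{s}\<close>
  factors through it and the condition that remains is factoring through \<alpha>.\<close>

lemma dhom_star_iff:
  assumes \<alpha>: "\<alpha> \<in> Rel X Y"
  shows "f \<in> dhom \<alpha> (star_k s) \<longleftrightarrow> (\<exists>v\<in>Rel Y {s}. f = v \<circ>\<^sub>Q \<alpha>)"
proof -
  have "v \<circ>\<^sub>Q \<alpha> = star_k s \<circ>\<^sub>Q (v \<circ>\<^sub>Q \<alpha>)" if "v \<in> Rel Y {s}" for v
    using id_rel_rcomp[OF rcomp_Rel[OF \<alpha> that]] by (simp add: star_k_eq_id_rel)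
  then show ?thesis
    unfolding dhom_iff[OF \<alpha> star_k_Rel] using rcomp_Rel[OF \<alpha>] by blast
qed

lemma D_ob_eq: "D_ob s \<alpha> = \<lparr>ob = dhom \<alpha> (star_k s), hom = rel_hom\<rparr>"
  by (simp add: D_ob_def DRel_def rel_hom_def fun_eq_iff)

text \<open>The underlying preorder of \<open>rel_hom\<close> is the pointwise order, whose
  antisymmetry yields skeletality.\<close>

lemma qcategory_rel_hom:
  assumes "\<And>f. f \<in> S \<Longrightarrow> f \<in> Rel X Y"
  shows "qcategory \<lparr>ob = S, hom = rel_hom\<rparr>" "skeletal \<lparr>ob = S, hom = rel_hom\<rparr>"
proof -
  show "qcategory \<lparr>ob = S, hom = rel_hom\<rparr>"
    by (simp add: qcategory_def rel_hom_trans[OF assms assms] one_le_rel_hom_iff[OF assms] rel_le_refl)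
  show "skeletal \<lparr>ob = S, hom = rel_hom\<rparr>"
    using rel_le_antisym[OF assms assms] by (simp add: skeletal_def one_le_rel_hom_iff[OF assms])
qed

lemma qcategory_D_ob:
  assumes "\<alpha> \<in> Rel X Y"
  shows "qcategory (D_ob s \<alpha>)" "skeletal (D_ob s \<alpha>)"
  unfolding D_ob_eq by (rule qcategory_rel_hom, erule dhomD(1)[OF _ assms star_k_Rel])+

text \<open>The colimit of a presheaf \<open>\<mu>\<close> is the join of the multiples \<open>\<mu> l * l\<close>; it is formed on the
  factors \<open>l \<Down>\<^sub>Q \<alpha>\<close> so that the result visibly factors through \<open>\<alpha>\<close>.\<close>

lemma cocomplete_D_ob:
  assumes \<alpha>: "\<alpha> \<in> Rel X Y"
  shows "cocomplete (D_ob s \<alpha>)"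
  unfolding cocomplete_iff_colimits[OF qcategory_D_ob(1)[OF \<alpha>]]
proof
  let ?D = "dhom \<alpha> (star_k s)"
  fix \<mu>
  let ?v = "\<lparr>src = Y, tgt = {s},
    val = (\<lambda>p\<in>Y \<times> {s}. SUP l\<in>?D. \<mu> l * val (l \<Down>\<^sub>Q \<alpha>) p)\<rparr>"
  note D = dhomD[OF _ \<alpha> star_k_Rel]
  have v: "?v \<in> Rel Y {s}" by (simp add: Rel_def)
  have "rel_hom (?v \<circ>\<^sub>Q \<alpha>) g = (INF l\<in>?D. \<mu> l \<rightarrow>\<^sub>Q rel_hom l g)" if g: "g \<in> ?D" for g
  proof (rule lower_set_eqI)
    fix q
    have l: "q \<le> \<mu> l \<rightarrow>\<^sub>Q rel_hom l g \<longleftrightarrow>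
        (\<forall>y\<in>Y. q * (\<mu> l * val (l \<Down>\<^sub>Q \<alpha>) (y, s)) \<le> val (g \<Down>\<^sub>Q \<alpha>) (y, s))" if "l \<in> ?D" for l
    proof -
      \<comment> \<open>Since \<open>l\<close> is
        \<open>(l \<Down>\<^sub>Q \<alpha>) \<circ>\<^sub>Q \<alpha>\<close>, its hom into
        \<open>g\<close> can be computed between the factors, where the join \<open>?v\<close> is
        formed.\<close>
      have "rel_hom l g = rel_hom (l \<Down>\<^sub>Q \<alpha>) (g \<Down>\<^sub>Q \<alpha>)"
        using rel_hom_rcomp[OF \<alpha> D(4)[OF that] D(1)[OF g]] D(2)[OF that] by simp
      moreover have "q \<le> \<mu> l \<rightarrow>\<^sub>Q p \<longleftrightarrow> q * \<mu> l \<le> p" for p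
        by (simp add: mult.commute flip: qimp_adjoint)
      ultimately show ?thesis
        by (simp add: le_rel_hom_iff[OF D(4)[OF that]] rel_le_iff[OF scal_Rel[OF D(4)[OF that]]]
            val_scal[OF D(4)[OF that]] mult.assoc)
    qed
    \<comment> \<open>Distributivity splits the join in \<open>?v\<close> into one condition for
      each \<open>l\<close>; up to the order of the quantifiers these are the conditions found above
      for the infimum.\<close>
    have "q \<le> rel_hom (?v \<circ>\<^sub>Q \<alpha>) g \<longleftrightarrow>
        (\<forall>y\<in>Y. \<forall>l\<in>?D. q * (\<mu> l * val (l \<Down>\<^sub>Q \<alpha>) (y, s)) \<le> val (g \<Down>\<^sub>Q \<alpha>) (y, s))"
      by (simp add: rel_hom_rcomp[OF \<alpha> v D(1)[OF g]] le_rel_hom_iff[OF v] rel_le_iff[OF scal_Rel[OF v]]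
          val_scal[OF v] quantale_mult_SUP SUP_le_iff)
    then show "q \<le> rel_hom (?v \<circ>\<^sub>Q \<alpha>) g \<longleftrightarrow> q \<le> (INF l\<in>?D. \<mu> l \<rightarrow>\<^sub>Q rel_hom l g)"
      by (auto simp: le_INF_iff l)
  qed
  moreover have "?v \<circ>\<^sub>Q \<alpha> \<in> ?D"
    unfolding dhom_star_iff[OF \<alpha>] by (intro bexI[of _ ?v] refl v)
  ultimately show "\<exists>c\<in>ob (D_ob s \<alpha>). \<forall>y\<in>ob (D_ob s \<alpha>).
      hom (D_ob s \<alpha>) c y = (INF x\<in>ob (D_ob s \<alpha>). \<mu> x \<rightarrow>\<^sub>Q hom (D_ob s \<alpha>) x y)"
    unfolding D_ob_eq qcat.simps by blast
qed

text \<open>Precomposition with \<open>u = \<alpha> \<Rrightarrow>\<^sub>Q f\<close> has the right adjoint \<open>- \<Down>\<^sub>Q u\<close> on all Q-relations;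
  it is brought back to morphisms out of \<open>\<alpha>\<close> by the coreflection \<open>l \<mapsto> (l \<Down>\<^sub>Q \<alpha>) \<circ>\<^sub>Q \<alpha>\<close>.\<close>

lemma qadjoint_precomp:
  assumes \<alpha>: "\<alpha> \<in> Rel X Y" and \<beta>: "\<beta> \<in> Rel X' Y'" and f: "f \<in> dhom \<beta> \<alpha>"
  shows "qadjoint (D_ob s \<alpha>) (D_ob s \<beta>) (\<lambda>l. l \<circ>\<^sub>Q (\<alpha> \<Rrightarrow>\<^sub>Q f))
    (\<lambda>m. ((m \<Down>\<^sub>Q (\<alpha> \<Rrightarrow>\<^sub>Q f)) \<Down>\<^sub>Q \<alpha>) \<circ>\<^sub>Q \<alpha>)"
proof (rule qadjointI[OF qcategory_D_ob(1)[OF \<alpha>] qcategory_D_ob(1)[OF \<beta>]])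
  let ?u = "\<alpha> \<Rrightarrow>\<^sub>Q f"
  note A = dhomD[OF _ \<alpha> star_k_Rel] and B = dhomD[OF _ \<beta> star_k_Rel]
  note u = dhomD(5)[OF f \<beta> \<alpha>]
  show "(\<lambda>l. l \<circ>\<^sub>Q ?u) \<in> ob (D_ob s \<alpha>) \<rightarrow> ob (D_ob s \<beta>)"
    using dhom_comp(2)[OF \<beta> \<alpha> star_k_Rel f] by (auto simp: D_ob_eq)
  show "(\<lambda>m. ((m \<Down>\<^sub>Q ?u) \<Down>\<^sub>Q \<alpha>) \<circ>\<^sub>Q \<alpha>) \<in> ob (D_ob s \<beta>) \<rightarrow> ob (D_ob s \<alpha>)"
  proof
    fix m assume "m \<in> ob (D_ob s \<beta>)"
    then have "m \<in> Rel X' {s}" using B(1)[of m s] by (simp add: D_ob_eq)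
    then show "((m \<Down>\<^sub>Q ?u) \<Down>\<^sub>Q \<alpha>) \<circ>\<^sub>Q \<alpha> \<in> ob (D_ob s \<alpha>)"
      using dhom_star_iff[OF \<alpha>, of _ s] res_sw_Rel[OF \<alpha> res_sw_Rel[OF u]]
      by (fastforce simp: D_ob_eq)
  qed
  fix l m assume "l \<in> ob (D_ob s \<alpha>)" "m \<in> ob (D_ob s \<beta>)"
  then have l: "l \<in> dhom \<alpha> (star_k s)" and m: "m \<in> dhom \<beta> (star_k s)" by (simp_all add: D_ob_eq)
  let ?n = "m \<Down>\<^sub>Q ?u"
  have n: "?n \<in> Rel X {s}" using res_sw_Rel[OF u B(1)[OF m]] .
  note r = res_sw_Rel[OF \<alpha> n]
  \<comment> \<open>Every multiple of \<open>l\<close> again factors through \<alpha>, and among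
    such Q-relations lying below \<open>?n\<close> is the same as lying below its
    coreflection.\<close>
  have unit: "rel_hom l ((?n \<Down>\<^sub>Q \<alpha>) \<circ>\<^sub>Q \<alpha>) = rel_hom l ?n"
  proof (rule lower_set_eqI)
    fix q
    note ql = scal_Rel[OF A(4)[OF l]]
    have ql_eq: "scal q l = scal q (l \<Down>\<^sub>Q \<alpha>) \<circ>\<^sub>Q \<alpha>"
      using scal_rcomp[OF \<alpha> A(4)[OF l]] A(2)[OF l] by simp
    have "rel_le (scal q l) ((?n \<Down>\<^sub>Q \<alpha>) \<circ>\<^sub>Q \<alpha>)" if "rel_le (scal q l) ?n"
      using that unfolding ql_eq res_sw_adjoint[OF \<alpha> ql n] by (rule rcomp_mono_left[OF \<alpha> ql r])
    moreover have "rel_le (scal q l) ?n" if "rel_le (scal q l) ((?n \<Down>\<^sub>Q \<alpha>) \<circ>\<^sub>Q \<alpha>)"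
      using rel_le_trans[OF scal_Rel[OF A(1)[OF l]] rcomp_Rel[OF \<alpha> r] that res_sw_counit[OF \<alpha> n]] .
    ultimately show "q \<le> rel_hom l ((?n \<Down>\<^sub>Q \<alpha>) \<circ>\<^sub>Q \<alpha>) \<longleftrightarrow> q \<le> rel_hom l ?n"
      by (auto simp: le_rel_hom_iff[OF A(1)[OF l]])
  qed
  show "hom (D_ob s \<beta>) (l \<circ>\<^sub>Q ?u) m = hom (D_ob s \<alpha>) l ((?n \<Down>\<^sub>Q \<alpha>) \<circ>\<^sub>Q \<alpha>)"
    using rel_hom_rcomp[OF u A(1)[OF l] B(1)[OF m]] unit by (simp add: D_ob_eq)
qed

lemma is_category_op_cat:
  assumes "is_category C"
  shows "is_category (op_cat C)"
  using assms unfolding is_category_def op_cat_def cat.simps by (intro conjI ballI) metis+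

text \<open>Arrows are sent to left adjoints by \<open>qadjoint_precomp\<close>; the functor laws
  are the unit and associativity laws of \<open>DRel\<close> for morphisms into
  \<open>star_k s\<close>.\<close>

lemma is_functor_D:
  "is_functor (op_cat DRel) QSup (D_ob s) (D_arr s)"
  unfolding is_functor_def
proof (intro conjI ballI)
  show "is_category (op_cat DRel)" by (rule is_category_op_cat[OF is_category_DRel])
  show "is_category QSup" by (rule is_category_QSup)
  have Rel: "\<alpha> \<in> Rel (src \<alpha>) (tgt \<alpha>)" if "\<alpha> \<in> Obj (op_cat DRel)" for \<alpha> :: "('a, 'a, 'b) qrel"
    using that by (simp add: op_cat_def DRel_def)
  have arr: "f \<in> dhom \<beta> \<alpha>" if "f \<in> Arr (op_cat DRel) \<alpha> \<beta>" for f \<alpha> \<beta> :: "('a, 'a, 'b) qrel"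
    using that by (simp add: op_cat_def DRel_def)
  have D_arr: "D_arr s \<alpha> \<beta> f = (\<lambda>l\<in>ob (D_ob s \<alpha>). l \<circ>\<^sub>Q (\<alpha> \<Rrightarrow>\<^sub>Q f))" for f \<alpha> \<beta> :: "('a, 'a, 'b) qrel"
    by (simp add: D_arr_def DRel_def)
  fix \<alpha> :: "('a, 'a, 'b) qrel" assume "\<alpha> \<in> Obj (op_cat DRel)"
  note \<alpha> = Rel[OF this]
  show "D_ob s \<alpha> \<in> Obj QSup"
    using qcategory_D_ob[OF \<alpha>] cocomplete_D_ob[OF \<alpha>] by (simp add: QSup_def)
  have "l \<circ>\<^sub>Q (\<alpha> \<Rrightarrow>\<^sub>Q \<alpha>) = l" if "l \<in> dhom \<alpha> (star_k s)" for l
    using dhom_comp(1)[OF \<alpha> \<alpha> star_k_Rel dhom_self[OF \<alpha>] that] dhomD(2)[OF that \<alpha> star_k_Rel]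
    by simp
  then show "D_arr s \<alpha> \<alpha> (Ident (op_cat DRel) \<alpha>) = Ident QSup (D_ob s \<alpha>)"
    by (auto simp: D_arr op_cat_def DRel_def QSup_def D_ob_eq)
  fix \<beta> :: "('a, 'a, 'b) qrel" assume "\<beta> \<in> Obj (op_cat DRel)"
  note \<beta> = Rel[OF this]
  fix f assume "f \<in> Arr (op_cat DRel) \<alpha> \<beta>"
  note f = arr[OF this]
  show "D_arr s \<alpha> \<beta> f \<in> Arr QSup (D_ob s \<alpha>) (D_ob s \<beta>)"
    using qsup_arr_restrict[OF qadjoint_precomp[OF \<alpha> \<beta> f]] by (simp add: D_arr QSup_def)
next
  show "D_arr s \<alpha> \<gamma> (Comp (op_cat DRel) \<alpha> \<beta> \<gamma> g f) =
      Comp QSup (D_ob s \<alpha>) (D_ob s \<beta>) (D_ob s \<gamma>) (D_arr s \<beta> \<gamma> g) (D_arr s \<alpha> \<beta> f)"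
    if "\<alpha> \<in> Obj (op_cat DRel)" "\<beta> \<in> Obj (op_cat DRel)" "\<gamma> \<in> Obj (op_cat DRel)"
      "f \<in> Arr (op_cat DRel) \<alpha> \<beta>" "g \<in> Arr (op_cat DRel) \<beta> \<gamma>"
    for \<alpha> \<beta> \<gamma> f g :: "('a, 'a, 'b) qrel"
  proof -
    have \<alpha>: "\<alpha> \<in> Obj DRel" and \<beta>: "\<beta> \<in> Obj DRel" and \<gamma>: "\<gamma> \<in> Obj DRel" and s: "star_k s \<in> Obj DRel"
      and f: "f \<in> Arr DRel \<beta> \<alpha>" and g: "g \<in> Arr DRel \<gamma> \<beta>"
      using that by (simp_all add: op_cat_def DRel_def Rel_sets[OF star_k_Rel] star_k_Rel)
    \<comment> \<open>Associativity is the composition law. The membership fact is needed because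
      the second map is restricted to morphisms \<beta> to \<open>star_k s\<close>, so the
      intermediate value must be one.\<close>
    have "Comp DRel \<gamma> \<alpha> (star_k s) l (Comp DRel \<gamma> \<beta> \<alpha> f g) =
        Comp DRel \<gamma> \<beta> (star_k s) (Comp DRel \<beta> \<alpha> (star_k s) l f) g"
      and "Comp DRel \<beta> \<alpha> (star_k s) l f \<in> Arr DRel \<beta> (star_k s)"
      if "l \<in> Arr DRel \<alpha> (star_k s)" for l
      using is_category_DRel \<alpha> \<beta> \<gamma> s f g that unfolding is_category_def by blast+
    then show ?thesis
      by (simp add: D_arr_def D_ob_def op_cat_def QSup_def compose_def fun_eq_iff)
  qed
qed

section \<open>Concept lattices as Q-categories of diagonal morphisms\<close>

lemma ob_concept_lattice: "ob (concept_lattice s \<alpha>) = property_concepts s \<alpha>"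
  by (simp add: concept_lattice_def)

lemma property_conceptsD:
  assumes "(l, m) \<in> property_concepts s \<alpha>" "\<alpha> \<in> Rel X Y"
  shows "l \<in> Rel Y {s}" "m \<in> Rel X {s}" "m \<Down>\<^sub>Q \<alpha> = l" "l \<circ>\<^sub>Q \<alpha> = m"
proof -
  have "l \<in> Rel Y {s} \<and> m \<in> Rel X {s} \<and> l = m \<Down>\<^sub>Q \<alpha> \<and> m = l \<circ>\<^sub>Q \<alpha>"
    using assms(1) unfolding property_concepts_def mem_Collect_eq case_prod_conv Rel_sets[OF assms(2)] .
  then show "l \<in> Rel Y {s}" "m \<in> Rel X {s}" "m \<Down>\<^sub>Q \<alpha> = l" "l \<circ>\<^sub>Q \<alpha> = m"
    by metis+
qed

text \<open>The hom is defined on the first components, where it is \<open>rel_hom l l'\<close>. As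
  \<open>m\<close> is \<open>l \<circ>\<^sub>Q \<alpha>\<close> and \<open>l'\<close> is
  \<open>m' \<Down>\<^sub>Q \<alpha>\<close>, the Q-valued adjunction transfers it to the second
  components.\<close>

lemma hom_concept_lattice:
  assumes "(l, m) \<in> property_concepts s \<alpha>" "(l', m') \<in> property_concepts s \<alpha>" "\<alpha> \<in> Rel X Y"
  shows "hom (concept_lattice s \<alpha>) (l, m) (l', m') = rel_hom m m'"
proof -
  note P = property_conceptsD[OF assms(1,3)] and P' = property_conceptsD[OF assms(2,3)]
  have "rel_hom m m' = rel_hom l l'"
    using rel_hom_rcomp[OF assms(3) P(1) P'(2)] unfolding P(4) P'(3) .
  then show ?thesis
    by (simp add: concept_lattice_def rel_hom_singleton[OF P(1) P'(1)])
qed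

lemma qcat_iso_concept_lattice:
  assumes \<alpha>: "\<alpha> \<in> Rel X Y"
  shows "qcat_iso (concept_lattice s \<alpha>) (D_ob s \<alpha>) (\<lambda>(l, m)\<in>ob (concept_lattice s \<alpha>). m)"
proof -
  let ?P = "property_concepts s \<alpha>" and ?F = "\<lambda>(l, m)\<in>property_concepts s \<alpha>. m"
  note P = property_conceptsD[OF _ \<alpha>] and D = dhomD[OF _ \<alpha> star_k_Rel]
  have hom: "hom (concept_lattice s \<alpha>) x y = rel_hom (?F x) (?F y)" if "x \<in> ?P" "y \<in> ?P" for x y
    using that hom_concept_lattice[OF _ _ \<alpha>] by (cases x; cases y) simp
  have F: "?F x \<in> Rel X {s}" if "x \<in> ?P" for x
    using that P(2) by (cases x) simp
  \<comment> \<open>The category laws are pulled back along \<open>?F\<close> from those of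
    \<open>rel_hom\<close>.\<close>
  have "qcategory (concept_lattice s \<alpha>)"
    unfolding qcategory_def ob_concept_lattice
  proof (intro conjI ballI)
    show "1 \<le> hom (concept_lattice s \<alpha>) x x" if x: "x \<in> ?P" for x
      by (simp only: hom[OF x x] one_le_rel_hom_iff[OF F[OF x]] rel_le_refl)
    show "hom (concept_lattice s \<alpha>) y z * hom (concept_lattice s \<alpha>) x y \<le> hom (concept_lattice s \<alpha>) x z"
      if x: "x \<in> ?P" and y: "y \<in> ?P" and z: "z \<in> ?P" for x y z
      unfolding hom[OF x y] hom[OF y z] hom[OF x z] by (rule rel_hom_trans[OF F[OF x] F[OF y]])
  qed
  moreover have "bij_betw ?F ?P (dhom \<alpha> (star_k s))"
  proof (rule bij_betwI[where g = "\<lambda>m. (m \<Down>\<^sub>Q \<alpha>, m)"])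
    show "?F \<in> ?P \<rightarrow> dhom \<alpha> (star_k s)"
    proof (rule funcsetI)
      fix x assume x: "x \<in> ?P"
      obtain l m where lm: "x = (l, m)" by (cases x)
      have "m \<in> dhom \<alpha> (star_k s)"
        using P(1,4)[OF x[unfolded lm]] dhom_star_iff[OF \<alpha>, of m s] by blast
      then show "?F x \<in> dhom \<alpha> (star_k s)" using x by (simp add: lm)
    qed
    \<comment> \<open>The first component of a concept is forced by the second; the remaining
      equation \<open>m = (m \<Down>\<^sub>Q \<alpha>) \<circ>\<^sub>Q \<alpha>\<close> is the fixed
      point condition for diagonal morphisms.\<close>
    have G: "(m \<Down>\<^sub>Q \<alpha>, m) \<in> ?P" if "m \<in> dhom \<alpha> (star_k s)" for m
      using D(1,2,4)[OF that] by (simp add: property_concepts_def Rel_sets[OF \<alpha>])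
    then show "(\<lambda>m. (m \<Down>\<^sub>Q \<alpha>, m)) \<in> dhom \<alpha> (star_k s) \<rightarrow> ?P" by blast
    show "?F (m \<Down>\<^sub>Q \<alpha>, m) = m" if "m \<in> dhom \<alpha> (star_k s)" for m
      using G[OF that] by simp
    show "((?F x) \<Down>\<^sub>Q \<alpha>, ?F x) = x" if "x \<in> ?P" for x
      using P(3) that by (cases x) simp
  qed
  ultimately show ?thesis
    using qcategory_D_ob(1)[OF \<alpha>, of s]
    unfolding qcat_iso_iff ob_concept_lattice D_ob_eq qcat.simps
    by (intro conjI ballI) (simp_all only: hom)
qed

theorem theorem4p2:
  fixes s :: 'u
  shows "(\<forall>X Y. \<forall>\<alpha> \<in> (Rel X Y :: ('u, 'u, 'q::comm_unital_quantale) qrel set).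
            qcat_iso (concept_lattice s \<alpha>) (D_ob s \<alpha>) (\<lambda>(l, m)\<in>ob (concept_lattice s \<alpha>). m))
       \<and> (\<exists>P_arr :: ('u, 'u, 'q) qrel \<Rightarrow> ('u, 'u, 'q) qrel \<Rightarrow> ('u, 'u, 'q) qrel
              \<Rightarrow> ('u, 'u, 'q) qrel \<times> ('u, 'u, 'q) qrel \<Rightarrow> ('u, 'u, 'q) qrel \<times> ('u, 'u, 'q) qrel.
            qsup_nat_iso (op_cat DRel) (concept_lattice s) P_arr (D_ob s) (D_arr s)
              (\<lambda>\<alpha>. \<lambda>(l, m)\<in>ob (concept_lattice s \<alpha>). m))"
proof (intro conjI allI ballI)
  fix X Y and \<alpha> :: "('u, 'u, 'q) qrel"
  assume "\<alpha> \<in> Rel X Y"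
  then show "qcat_iso (concept_lattice s \<alpha>) (D_ob s \<alpha>) (\<lambda>(l, m)\<in>ob (concept_lattice s \<alpha>). m)"
    by (rule qcat_iso_concept_lattice)
next
  have "\<alpha> \<in> Rel (src \<alpha>) (tgt \<alpha>)" if "\<alpha> \<in> Obj (op_cat DRel)" for \<alpha> :: "('u, 'u, 'q) qrel"
    using that by (simp add: op_cat_def DRel_def)
  then show "\<exists>P_arr :: ('u, 'u, 'q) qrel \<Rightarrow> ('u, 'u, 'q) qrel \<Rightarrow> ('u, 'u, 'q) qrel
              \<Rightarrow> ('u, 'u, 'q) qrel \<times> ('u, 'u, 'q) qrel \<Rightarrow> ('u, 'u, 'q) qrel \<times> ('u, 'u, 'q) qrel.
            qsup_nat_iso (op_cat DRel) (concept_lattice s) P_arr (D_ob s) (D_arr s)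
              (\<lambda>\<alpha>. \<lambda>(l, m)\<in>ob (concept_lattice s \<alpha>). m)"
    \<comment> \<open>The witness for \<open>P_arr\<close> is the representable functor conjugated
      by the isomorphisms \<open>(l, m) \<mapsto> m\<close>.\<close>
    by (intro qsup_functor_transport is_functor_D qcat_iso_concept_lattice) simp_all
qed

end
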